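(* Let $1\leq p<\infty$ and let $\{\phi_t\}_{t\geq0}$ be a semigroup of analytic self-maps of the unit disc $\mathbb{D}$ with infinitesimal generator $G$ and Denjoy-Wolff point $b\in\mathbb{D}$. If $VMOA_p=[\phi_t,BMOA_p]$, then $$\lim_{|I|\to0}\frac{1}{|I|}\int_{S(I)}\frac{(1-|z|^2)^{p-1}}{|G(z)|^p}\,dm(z)=0.$$
   Context: $\mathbb{D}$ is the open unit disc, $H(\mathbb{D})$ the space of analytic functions on $\mathbb{D}$, $dm$ the normalized Lebesgue area measure on $\mathbb{D}$, and $\varphi_a(z)=\frac{a-z}{1-\bar a z}$ for $a\in\mathbb{D}$. For $p\geq 1$, $BMOA_p$ is the Banach space of $f\in H(\mathbb{D})$ with finite norm $$\|f\|_{BMOA_p}^p=|f(0)|^p+\sup_{a\in\mathbb{D}}\int_{\mathbb{D}}|f'(z)|^p(1-|z|^2)^{p-2}(1-|\varphi_a(z)|^2)\,dm(z).$$ $VMOA_p$ is the closed subspace of those $f\in BMOA_p$ for which $\lim_{|a|\to1}\int_{\mathbb{D}}|f'(z)|^p(1-|z|^2)^{p-2}(1-|\varphi_a(z)|^2)\,dm(z)=0$. A semigroup of functions is a family $\{\phi_t\}_{t\geq0}$ of analytic self-maps of $\mathbb{D}$ such that $\phi_0(z)=z$; $\phi_t\circ\phi_s=\phi_{t+s}$ for all $t,s\geq0$; and $\phi_t\to\phi_0$ uniformly on compact subsets of $\mathbb{D}$ as $t\to0$. Its infinitesimal generator is the analytic function $G(z)=\lim_{t\to0^+}\frac{\phi_t(z)-z}{t}$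 (the limit exists uniformly on compact subsets of $\mathbb{D}$). By Berkson and Porta, $G$ has the representation $G(z)=(\bar b z-1)(z-b)P(z)$ with $b\in\overline{\mathbb{D}}$ and $P\in H(\mathbb{D})$, $\operatorname{Re}P\geq0$ on $\mathbb{D}$, unique for nontrivial semigroups; $b$ is the Denjoy-Wolff point of the semigroup. For a Banach space $X$ of analytic functions, $[\phi_t,X]=\{f\in X:\lim_{t\to0^+}\|f\circ\phi_t-f\|_X=0\}$. For an arc $I\subset\partial\mathbb{D}$ of length $|I|$, the Carleson square is $S(I)=\{re^{it}:e^{it}\in I,\ 1-|I|<r<1\}$; the limit as $|I|\to0$ is uniform over all arcs $I$ with $|I|\to 0$. *)

theory Defs
  imports "HOL-Complex_Analysis.Complex_Analysis"
begin

abbreviation unit_disc :: "complex set" where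
  "unit_disc \<equiv> ball 0 1"

definition area_measure :: "complex measure" where
  "area_measure = uniform_measure lborel unit_disc"

definition disc_aut :: "complex \<Rightarrow> complex \<Rightarrow> complex" where
  "disc_aut a z = (a - z) / (1 - cnj a * z)"

definition bmoa_integral :: "real \<Rightarrow> (complex \<Rightarrow> complex) \<Rightarrow> complex \<Rightarrow> ennreal" where
  "bmoa_integral p f a =
    (\<integral>\<^sup>+z\<in>unit_disc. ennreal (norm (deriv f z) powr p * (1 - (norm z)\<^sup>2) powr (p - 2)
        * (1 - (norm (disc_aut a z))\<^sup>2)) \<partial>area_measure)"

definition bmoa_norm_power :: "real \<Rightarrow> (complex \<Rightarrow> complex) \<Rightarrow> ennreal" where
  "bmoa_norm_power p f =
    ennreal (norm (f 0) powr p) + (SUP a\<in>unit_disc. bmoa_integral p f a)"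

text \<open>The norm is extended-valued, so that the \<open>p\<close>-th root has to send \<open>\<infinity>\<close> to \<open>\<infinity>\<close>.\<close>

definition bmoa_norm :: "real \<Rightarrow> (complex \<Rightarrow> complex) \<Rightarrow> ennreal" where
  "bmoa_norm p f =
    (if bmoa_norm_power p f = \<infinity> then \<infinity>
     else ennreal (enn2real (bmoa_norm_power p f) powr (1 / p)))"

text \<open>Functions on the disc are represented by total functions. All notions below depend only on
  the values inside the disc, so values elsewhere are unconstrained.\<close>

definition BMOA :: "real \<Rightarrow> (complex \<Rightarrow> complex) set" where
  "BMOA p = {f. f holomorphic_on unit_disc \<and> bmoa_norm p f < \<infinity>}"

definition VMOA :: "real \<Rightarrow> (complex \<Rightarrow> complex) set" where
  "VMOA p = {f \<in> BMOA p. (bmoa_integral p f \<longlongrightarrow> 0) (filtercomap norm (at_left 1))}"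

definition disc_semigroup :: "(real \<Rightarrow> complex \<Rightarrow> complex) \<Rightarrow> bool" where
  "disc_semigroup \<phi> \<longleftrightarrow>
    (\<forall>t\<ge>0. \<phi> t holomorphic_on unit_disc \<and> \<phi> t ` unit_disc \<subseteq> unit_disc) \<and>
    (\<forall>z\<in>unit_disc. \<phi> 0 z = z) \<and>
    (\<forall>t\<ge>0. \<forall>s\<ge>0. \<forall>z\<in>unit_disc. \<phi> t (\<phi> s z) = \<phi> (t + s) z) \<and>
    (\<forall>K. compact K \<and> K \<subseteq> unit_disc \<longrightarrow> uniform_limit K \<phi> (\<phi> 0) (at_right 0))"

text \<open>For a semigroup the limit always exists, locally uniformly in the disc, so that the
  generator is automatically analytic there.\<close>

definition infinitesimal_generator ::
    "(real \<Rightarrow> complex \<Rightarrow> complex) \<Rightarrow> (complex \<Rightarrow> complex) \<Rightarrow> bool" where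
  "infinitesimal_generator \<phi> G \<longleftrightarrow>
    (\<forall>z\<in>unit_disc. ((\<lambda>t. (\<phi> t z - z) / of_real t) \<longlongrightarrow> G z) (at_right 0))"

text \<open>The point \<open>b\<close> of the Berkson--Porta representation of the generator. It is unique unless the
  semigroup is trivial.\<close>

definition denjoy_wolff_point :: "(real \<Rightarrow> complex \<Rightarrow> complex) \<Rightarrow> complex \<Rightarrow> bool" where
  "denjoy_wolff_point \<phi> b \<longleftrightarrow> b \<in> cball 0 1 \<and>
    (\<exists>G P. infinitesimal_generator \<phi> G \<and> P holomorphic_on unit_disc \<and>
      (\<forall>z\<in>unit_disc. Re (P z) \<ge> 0 \<and> G z = (cnj b * z - 1) * (z - b) * P z))"

definition strong_continuity_subspace ::
    "(real \<Rightarrow> complex \<Rightarrow> complex) \<Rightarrow> (complex \<Rightarrow> complex) set \<Rightarrow>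
     ((complex \<Rightarrow> complex) \<Rightarrow> ennreal) \<Rightarrow> (complex \<Rightarrow> complex) set" where
  "strong_continuity_subspace \<phi> X N =
    {f \<in> X. ((\<lambda>t. N (\<lambda>z. f (\<phi> t z) - f z)) \<longlongrightarrow> 0) (at_right 0)}"

text \<open>\<open>I\<close> is an arc of length \<open>l\<close>; each endpoint may or may not belong to it.\<close>

definition circle_arc :: "complex set \<Rightarrow> real \<Rightarrow> bool" where
  "circle_arc I l \<longleftrightarrow> 0 < l \<and> l \<le> 2 * pi \<and>
    (\<exists>\<alpha>. cis ` {\<alpha><..<\<alpha> + l} \<subseteq> I \<and> I \<subseteq> cis ` {\<alpha>..\<alpha> + l})"

definition carleson_square :: "complex set \<Rightarrow> real \<Rightarrow> complex set" where
  "carleson_square I l = {of_real r * w |r w. w \<in> I \<and> 0 \<le> r \<and> 1 - l < r \<and> r < 1}"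

end

theory Submission
  imports Defs
begin

text \<open>
  Write \<open>G z = (cnj b * z - 1) * (z - b) * P z\<close> and let \<open>\<gamma>\<close> be a primitive of
  \<open>1 / ((cnj b * z - 1) * P z)\<close>, so that \<open>\<gamma>' * G = z - b\<close>. As \<open>z - b\<close> is bounded away from \<open>0\<close> near the
  circle, the conclusion amounts to \<open>\<gamma> \<in> VMOA p\<close>, and by hypothesis it suffices that \<open>\<gamma> \<in> BMOA p\<close> and that \<open>h\<^sub>t = \<gamma> \<circ> \<phi> t - \<gamma>\<close> tends to \<open>0\<close> in norm.

  Both facts rest on one estimate. If \<open>Re Q > 0\<close>, then \<open>sqrt \<bar>Q\<bar> * (1 - \<bar>z\<bar>\<^sup>2) powr (- 1/2)\<close> is the density of
  a Carleson measure. Hence a function with \<open>\<bar>f'\<bar> \<le> C * \<bar>Q\<bar>\<close> and \<open>\<bar>f'\<bar> \<le> B / (1 - \<bar>z\<bar>\<^sup>2)\<close> has seminorm to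
  the power \<open>p\<close> at most a constant times \<open>B powr (p - 1/2)\<close>. For \<open>Q = 1 / P + 1\<close> this covers \<open>\<gamma>\<close>, with some \<open>B\<close>.
  It covers \<open>h\<^sub>t\<close> with \<open>B = 4 * t\<close>: the derivative of \<open>\<gamma> (\<phi> t z)\<close> in \<open>t\<close> is \<open>\<phi> t z - b\<close>, so that
  \<open>\<bar>h\<^sub>t\<bar> \<le> 2 * t\<close>, while \<open>(\<phi> t)' * G = G \<circ> \<phi> t\<close> gives \<open>(z - b) * h\<^sub>t' = (\<phi> t z - z) * \<gamma>'\<close>.
\<close>

section \<open>Area measure in the plane\<close>

text \<open>A Borel measure that gives every box the product of its side lengths is Lebesgue
  measure, and the preimage of a box is a product of two intervals. This opens plane integrals to
  Tonelli's theorem in real coordinates.\<close>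

lemma lborel_complex_eq_distr:
  "(lborel :: complex measure) = distr (lborel \<Otimes>\<^sub>M lborel) borel (\<lambda>(x, y). Complex x y)"
proof (rule lborel_eqI)
  have [measurable]: "(\<lambda>(x, y). Complex x y) \<in> borel_measurable (lborel \<Otimes>\<^sub>M lborel)"
    unfolding Complex_eq by measurable
  fix l u :: complex
  assume *: "\<And>b. b \<in> Basis \<Longrightarrow> l \<bullet> b \<le> u \<bullet> b"
  have le: "Re l \<le> Re u" "Im l \<le> Im u"
    using *[of 1] *[of \<i>] by (auto simp: Basis_complex_def)
  have "(\<lambda>(x, y). Complex x y) -` box l u \<inter> space (lborel \<Otimes>\<^sub>M lborel)
      = {Re l<..<Re u} \<times> {Im l<..<Im u}"
    by (auto simp: in_box_complex_iff space_pair_measure)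
  then show "emeasure (distr (lborel \<Otimes>\<^sub>M lborel) borel (\<lambda>(x, y). Complex x y)) (box l u)
      = ennreal (\<Prod>b\<in>Basis. (u - l) \<bullet> b)"
    using le by (simp add: emeasure_distr lborel.emeasure_pair_measure_Times Basis_complex_def
        ennreal_mult)
qed simp

lemma nn_integral_complex:
  assumes [measurable]: "f \<in> borel_measurable borel"
  shows "(\<integral>\<^sup>+z. f z \<partial>lborel) = (\<integral>\<^sup>+x. \<integral>\<^sup>+y. f (Complex x y) \<partial>lborel \<partial>lborel)"
    and "(\<integral>\<^sup>+z. f z \<partial>lborel) = (\<integral>\<^sup>+y. \<integral>\<^sup>+x. f (Complex x y) \<partial>lborel \<partial>lborel)"
proof -
  have [measurable]: "(\<lambda>(x, y). Complex x y) \<in> borel_measurable (lborel \<Otimes>\<^sub>M lborel)"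
    unfolding Complex_eq by measurable
  have [measurable]: "(\<lambda>(x, y). f (Complex x y)) \<in> borel_measurable (lborel \<Otimes>\<^sub>M lborel)"
    unfolding Complex_eq by measurable
  have eq: "(\<integral>\<^sup>+z. f z \<partial>lborel) = (\<integral>\<^sup>+p. (\<lambda>(x, y). f (Complex x y)) p \<partial>(lborel \<Otimes>\<^sub>M lborel))"
    by (subst lborel_complex_eq_distr, subst nn_integral_distr) (auto simp: case_prod_unfold)
  show "(\<integral>\<^sup>+z. f z \<partial>lborel) = (\<integral>\<^sup>+x. \<integral>\<^sup>+y. f (Complex x y) \<partial>lborel \<partial>lborel)"
    unfolding eq by (subst lborel.nn_integral_fst[symmetric]) auto
  show "(\<integral>\<^sup>+z. f z \<partial>lborel) = (\<integral>\<^sup>+y. \<integral>\<^sup>+x. f (Complex x y) \<partial>lborel \<partial>lborel)"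
    unfolding eq by (subst lborel_pair.nn_integral_snd[symmetric]) auto
qed

text \<open>With the controlling coordinate held fixed, the other one is merely translated; each
  direction uses the order of integration whose inner variable is the sheared one.\<close>

lemma nn_integral_complex_shear:
  assumes [measurable]: "f \<in> borel_measurable borel"
  shows "(\<integral>\<^sup>+z. f (Complex (Re z + s * Im z) (Im z)) \<partial>lborel) = (\<integral>\<^sup>+z. f z \<partial>lborel)"
    and "(\<integral>\<^sup>+z. f (Complex (Re z) (Im z + s * Re z)) \<partial>lborel) = (\<integral>\<^sup>+z. f z \<partial>lborel)"
proof -
  have m [measurable]: "(\<lambda>x. f (Complex (u x) (v x))) \<in> borel_measurable M"
    if [measurable]: "u \<in> borel_measurable M" "v \<in> borel_measurable M" for u v and M :: "'b measure"
    unfolding Complex_eq by measurable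
  have x: "(\<integral>\<^sup>+x. f (Complex (x + s * y) y) \<partial>lborel) = (\<integral>\<^sup>+x. f (Complex x y) \<partial>lborel)" for y
    using nn_integral_real_affine[of "\<lambda>x. f (Complex x y)" 1 "s * y"] by (simp add: m add.commute)
  have y: "(\<integral>\<^sup>+y. f (Complex x (y + s * x)) \<partial>lborel) = (\<integral>\<^sup>+y. f (Complex x y) \<partial>lborel)" for x
    using nn_integral_real_affine[of "\<lambda>y. f (Complex x y)" 1 "s * x"] by (simp add: m add.commute)
  show "(\<integral>\<^sup>+z. f (Complex (Re z + s * Im z) (Im z)) \<partial>lborel) = (\<integral>\<^sup>+z. f z \<partial>lborel)"
    by (subst (1 2) nn_integral_complex(2)) (simp_all add: m x)
  show "(\<integral>\<^sup>+z. f (Complex (Re z) (Im z + s * Re z)) \<partial>lborel) = (\<integral>\<^sup>+z. f z \<partial>lborel)"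
    by (subst (1 2) nn_integral_complex(1)) (simp_all add: m y)
qed

text \<open>A rotation whose angle is not a multiple of \<open>\<pi>\<close> is a product of three shears.\<close>

lemma nn_integral_complex_rotation:
  fixes c :: complex
  assumes [measurable]: "f \<in> borel_measurable borel" and c: "norm c = 1"
  shows "(\<integral>\<^sup>+z. f (c * z) \<partial>lborel) = (\<integral>\<^sup>+z. f z \<partial>lborel)"
proof -
  have rot: "(\<integral>\<^sup>+z. g (d * z) \<partial>lborel) = (\<integral>\<^sup>+z. g z \<partial>lborel)"
    if g [measurable]: "g \<in> borel_measurable borel" and d: "norm d = 1" "Im d \<noteq> 0"
    for g :: "complex \<Rightarrow> ennreal" and d
  proof -
    \<comment> \<open>For \<open>d = cis \<theta>\<close> this is
      \<open>- tan (\<theta> / 2)\<close>. The three shears are horizontal by \<open>s\<close>,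
      vertical by \<open>Im d = sin \<theta>\<close>, and horizontal by \<open>s\<close>
      again.\<close>
    define s where "s = (Re d - 1) / Im d"
    have sq: "Re d * Re d + Im d * Im d = 1"
      using d by (simp add: cmod_def power2_eq_square)
    let ?X = "\<lambda>z. Complex (Re z + s * Im z) (Im z)" and ?Y = "\<lambda>z. Complex (Re z) (Im z + Im d * Re z)"
    have [measurable]: "?X \<in> borel_measurable borel" "?Y \<in> borel_measurable borel"
      unfolding Complex_eq by measurable
    have "d * z = ?X (?Y (?X z))" for z
    proof (rule complex_eqI)
      have s: "s * Im d = Re d - 1" using d by (simp add: s_def)
      have ss: "2 * s + s * s * Im d = - Im d"
      proof -
        have "(2 * s + s * s * Im d) * Im d = 2 * (s * Im d) + (s * Im d) * (s * Im d)"
          by (simp add: algebra_simps)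
        also have "\<dots> = - Im d * Im d"
          unfolding s using sq by (simp add: algebra_simps)
        finally have "(2 * s + s * s * Im d) * Im d = (- Im d) * Im d" by simp
        then show ?thesis using mult_right_cancel[OF d(2)] by blast
      qed
      have "Re (?X (?Y (?X z))) = Re z + s * Im d * Re z + (2 * s + s * s * Im d) * Im z"
        by (simp add: algebra_simps)
      then show "Re (d * z) = Re (?X (?Y (?X z)))"
        unfolding s ss by (simp add: algebra_simps)
      have "Im (?X (?Y (?X z))) = Im z + s * Im d * Im z + Im d * Re z"
        by (simp add: algebra_simps)
      then show "Im (d * z) = Im (?X (?Y (?X z)))"
        unfolding s by (simp add: algebra_simps)
    qed
    then have "(\<integral>\<^sup>+z. g (d * z) \<partial>lborel) = (\<integral>\<^sup>+z. (\<lambda>z. g (?X (?Y z))) (?X z) \<partial>lborel)"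
      by simp
    also have "\<dots> = (\<integral>\<^sup>+z. (\<lambda>z. g (?X z)) (?Y z) \<partial>lborel)"
      by (rule nn_integral_complex_shear(1)) measurable
    also have "\<dots> = (\<integral>\<^sup>+z. g (?X z) \<partial>lborel)"
      by (rule nn_integral_complex_shear(2)) measurable
    also have "\<dots> = (\<integral>\<^sup>+z. g z \<partial>lborel)"
      by (rule nn_integral_complex_shear(1)) measurable
    finally show ?thesis .
  qed
  show ?thesis
  proof (cases "Im c = 0")
    case True
    then have "c = 1 \<or> c = -1"
      using c by (auto simp: complex_eq_iff cmod_def)
    \<comment> \<open>A half turn is two quarter turns, and \<open>\<i>\<close> has nonzero
      imaginary part.\<close>
    moreover have "(\<integral>\<^sup>+z. f (- z) \<partial>lborel) = (\<integral>\<^sup>+z. f z \<partial>lborel)"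
      using rot[of "\<lambda>z. f (\<i> * z)" \<i>] rot[of f \<i>]
      by (simp flip: mult.assoc)
    ultimately show ?thesis by auto
  qed (simp add: rot c)
qed

text \<open>A disc of radius \<open>r\<close> has area \<open>pi * r\<^sup>2\<close>, so the squared
  modulus carries Lebesgue measure on the unit disc to \<open>pi\<close> times Lebesgue measure on
  the unit interval, without a Jacobian. The two measures are compared on half-lines.\<close>

lemma nn_integral_disc_radial:
  assumes [measurable]: "g \<in> borel_measurable borel"
  shows "(\<integral>\<^sup>+z\<in>ball (0::complex) 1. g ((norm z)\<^sup>2) \<partial>lborel)
    = ennreal pi * (\<integral>\<^sup>+u\<in>{0<..<1::real}. g u \<partial>lborel)"
proof -
  let ?B = "ball (0::complex) 1"
  let ?M = "distr (density lborel (indicator ?B)) borel (\<lambda>z::complex. (norm z)\<^sup>2)"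
  let ?N = "density lborel (\<lambda>u::real. ennreal pi * indicator {0<..<1} u)"
  have vol: "emeasure lborel (ball (0::complex) r) = ennreal (pi * r\<^sup>2)"
      "emeasure lborel (cball (0::complex) r) = ennreal (pi * r\<^sup>2)" if "r \<ge> 0" for r
    using that by (simp_all add: emeasure_ball emeasure_cball unit_ball_vol_2)
  have M: "emeasure ?M {x<..} = (if x < 0 then ennreal pi else ennreal (pi * (1 - min x 1)))" for x
  proof -
    have [measurable]: "{z::complex. x < (norm z)\<^sup>2} \<in> sets borel" by measurable
    have "emeasure ?M {x<..} = emeasure lborel (?B \<inter> {z. x < (norm z)\<^sup>2})"
      by (subst emeasure_distr, simp, simp, subst emeasure_density)
         (simp_all add: vimage_def borel_measurable_indicator flip: indicator_inter_arith)
    also have "\<dots> = (if x < 0 then ennreal pi else ennreal (pi * (1 - min x 1)))"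
    proof (cases "x < 0")
      case True
      then have "{z::complex. x < (norm z)\<^sup>2} = UNIV"
        by (auto intro: less_le_trans)
      then show ?thesis using True vol(1)[of 1] by simp
    next
      case False
      \<comment> \<open>The minimum covers \<open>x \<ge> 1\<close> as well: then
        \<open>r = 1\<close> and the region is empty.\<close>
      define r where "r = sqrt (min x 1)"
      have r: "0 \<le> r" "r\<^sup>2 = min x 1" "r \<le> 1" using False by (auto simp: r_def)
      have key: "x < (norm z)\<^sup>2 \<longleftrightarrow> r < norm z" if "norm z < 1" for z :: complex
      proof -
        have "(norm z)\<^sup>2 < 1" using that by (simp add: abs_square_less_1)
        then have "x < (norm z)\<^sup>2 \<longleftrightarrow> min x 1 < (norm z)\<^sup>2" by auto
        also have "\<dots> \<longleftrightarrow> r < sqrt ((norm z)\<^sup>2)" unfolding r_def by (simp only: real_sqrt_less_iff)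
        finally show ?thesis by simp
      qed
      have "?B \<inter> {z. x < (norm z)\<^sup>2} = ?B - cball 0 r"
        using key by (auto simp: not_le)
      then have 1: "emeasure lborel (?B \<inter> {z. x < (norm z)\<^sup>2}) = emeasure lborel (?B - cball 0 r)"
        by simp
      show ?thesis
      proof (cases "r = 1")
        case True
        then have "?B - cball 0 r = {}" by auto
        then have "emeasure lborel (?B - cball 0 r) = 0" by (simp only: emeasure_empty)
        moreover have "min x 1 = 1" using True r by simp
        ultimately show ?thesis using 1 False by (simp only:) simp
      next
        case False2: False
        then have "cball 0 r \<subseteq> ?B" using r by auto
        then have "emeasure lborel (?B - cball 0 r) = ennreal (pi * 1\<^sup>2) - ennreal (pi * r\<^sup>2)"
          using r vol by (subst emeasure_Diff) auto
        also have "\<dots> = ennreal (pi * (1 - min x 1))"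
          using r False by (simp add: ennreal_minus algebra_simps)
        finally show ?thesis using 1 False by simp
      qed
    qed
    finally show ?thesis .
  qed
  have N: "emeasure ?N {x<..} = (if x < 0 then ennreal pi else ennreal (pi * (1 - min x 1)))" for x
  proof -
    have "emeasure ?N {x<..} = ennreal pi * emeasure lborel ({0<..<1} \<inter> {x<..})"
      by (subst emeasure_density)
         (auto simp: mult.assoc nn_integral_cmult simp flip: indicator_inter_arith)
    also have "{0<..<1} \<inter> {x<..} = {max 0 x<..<1}" by auto
    finally show ?thesis
      by (auto simp: ennreal_mult' min_def max_def)
  qed
  have "?M = ?N"
    by (rule measure_eqI_lessThan) (simp_all only: M N, auto)
  have "(\<integral>\<^sup>+z\<in>?B. g ((norm z)\<^sup>2) \<partial>lborel) = (\<integral>\<^sup>+u. g u \<partial>?M)"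
    by (subst nn_integral_distr, simp, simp, subst nn_integral_density)
       (auto simp: mult.commute borel_measurable_indicator intro!: nn_integral_cong)
  also have "\<dots> = (\<integral>\<^sup>+u. g u \<partial>?N)"
    by (simp only: \<open>?M = ?N\<close>)
  also have "\<dots> = (\<integral>\<^sup>+u. ennreal pi * (g u * indicator {0<..<1} u) \<partial>lborel)"
    by (subst nn_integral_density) (auto simp: mult_ac intro!: nn_integral_cong)
  also have "\<dots> = ennreal pi * (\<integral>\<^sup>+u\<in>{0<..<1::real}. g u \<partial>lborel)"
    by (rule nn_integral_cmult) measurable
  finally show ?thesis .
qed

section \<open>Functions on the disc\<close>

text \<open>The Schwarz lemma applies to \<open>(f - f w) / 2\<close> on the disc of radius
  \<open>1 - norm w\<close> about \<open>w\<close>, rescaled to the unit disc. Farther away from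
  \<open>w\<close> the trivial bound 2 is enough. The constant does not depend on \<open>f\<close>,
  which makes later estimates uniform in time.\<close>

lemma disc_self_map_lipschitz:
  assumes f: "f holomorphic_on unit_disc" "f ` unit_disc \<subseteq> unit_disc"
    and z: "z \<in> unit_disc" and w: "w \<in> unit_disc"
  shows "norm (f z - f w) \<le> 2 * norm (z - w) / (1 - norm w)"
proof -
  define \<rho> where "\<rho> = 1 - norm w"
  have \<rho>: "\<rho> > 0" using w by (simp add: \<rho>_def)
  have fb: "norm (f u) < 1" if "u \<in> unit_disc" for u
    using f(2) that by (auto simp: image_subset_iff)
  have f2: "norm (f z - f w) < 2"
    using norm_triangle_ineq4[of "f z" "f w"] fb[OF z] fb[OF w] by linarith
  show ?thesis
  proof (cases "norm (z - w) < \<rho>")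
    case False
    then have "2 * 1 \<le> 2 * (norm (z - w) / \<rho>)"
      using \<rho> by (simp add: field_simps)
    then show ?thesis using f2 by (simp add: \<rho>_def)
  next
    case True
    define g where "g = (\<lambda>u. (f (w + of_real \<rho> * u) - f w) / 2)"
    have in_disc: "w + of_real \<rho> * u \<in> unit_disc" if "norm u < 1" for u
    proof -
      have "norm (w + of_real \<rho> * u) \<le> norm w + \<rho> * norm u"
        using \<rho> norm_triangle_ineq[of w "of_real \<rho> * u"] by (simp add: norm_mult)
      also have "\<dots> < norm w + \<rho> * 1"
        using \<rho> that by (intro add_strict_left_mono mult_strict_left_mono) auto
      finally show ?thesis by (simp add: \<rho>_def)
    qed
    have "(f \<circ> (\<lambda>u. w + of_real \<rho> * u)) holomorphic_on ball 0 1"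
      by (rule holomorphic_on_compose_gen[OF _ f(1)]) (use in_disc in \<open>auto intro!: holomorphic_intros\<close>)
    then have "g holomorphic_on ball 0 1"
      unfolding g_def o_def by (intro holomorphic_intros) auto
    moreover have "norm (g u) < 1" if "norm u < 1" for u
      using norm_triangle_ineq4[of "f (w + of_real \<rho> * u)" "f w"] fb[OF in_disc[OF that]] fb[OF w]
      unfolding g_def by (simp add: norm_divide)
    moreover have "g 0 = 0" by (simp add: g_def)
    moreover have "norm ((z - w) / of_real \<rho>) < 1"
      using True \<rho> by (simp add: norm_divide)
    ultimately have "norm (g ((z - w) / of_real \<rho>)) \<le> norm ((z - w) / of_real \<rho>)"
      by (intro Schwarz_Lemma(1)) auto
    then show ?thesis
      using \<rho> by (simp add: g_def norm_divide \<rho>_def[symmetric] field_simps)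
  qed
qed

text \<open>Cauchy's inequality on circles of radius \<open>r < 1 - norm z\<close>, with
  \<open>r\<close> tending to \<open>1 - norm z\<close>; the factor 2 comes from
  \<open>1 - (norm z)\<^sup>2 \<le> 2 * (1 - norm z)\<close>.\<close>

lemma disc_deriv_bound:
  assumes f: "f holomorphic_on unit_disc" and B: "\<And>z. z \<in> unit_disc \<Longrightarrow> norm (f z) \<le> B"
    and z: "z \<in> unit_disc"
  shows "norm (deriv f z) \<le> 2 * B / (1 - (norm z)\<^sup>2)"
proof -
  define \<rho> where "\<rho> = 1 - norm z"
  have \<rho>: "\<rho> > 0" using z by (simp add: \<rho>_def)
  have B0: "0 \<le> B" using B[OF z] norm_ge_zero order_trans by blast
  have *: "norm (deriv f z) * r \<le> B" if r: "0 < r" "r < \<rho>" for r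
  proof -
    have sub: "cball z r \<subseteq> unit_disc"
    proof
      fix x assume "x \<in> cball z r"
      then show "x \<in> unit_disc"
        using r norm_triangle_ineq[of z "x - z"] by (auto simp: \<rho>_def dist_norm norm_minus_commute)
    qed
    have hol: "f holomorphic_on cball z r"
      using f sub by (rule holomorphic_on_subset)
    have "norm ((deriv ^^ 1) f z) \<le> fact 1 * B / r ^ 1"
    proof (rule Cauchy_inequality)
      show "f holomorphic_on ball z r"
        using hol ball_subset_cball by (rule holomorphic_on_subset)
      show "norm (f x) \<le> B" if "norm (z - x) = r" for x
        using that sub by (intro B) (auto simp: dist_norm)
    qed (use hol r in \<open>auto intro: holomorphic_on_imp_continuous_on\<close>)
    then show ?thesis using r by (simp add: field_simps)
  qed
  have "norm (deriv f z) * \<rho> \<le> B"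
  proof (rule tendsto_upperbound)
    show "((\<lambda>r. norm (deriv f z) * r) \<longlongrightarrow> norm (deriv f z) * \<rho>) (at_left \<rho>)"
      by (intro tendsto_intros)
    show "\<forall>\<^sub>F r in at_left \<rho>. norm (deriv f z) * r \<le> B"
      using eventually_at_left_real[OF \<rho>] by eventually_elim (use * in auto)
  qed auto
  moreover have "1 - (norm z)\<^sup>2 \<le> 2 * \<rho>"
  proof -
    have "2 * \<rho> - (1 - (norm z)\<^sup>2) = (1 - norm z)\<^sup>2"
      by (simp add: \<rho>_def power2_eq_square algebra_simps)
    then show ?thesis by (smt (verit) zero_le_power2)
  qed
  ultimately have "norm (deriv f z) * (1 - (norm z)\<^sup>2) \<le> 2 * B"
    using mult_left_mono[of "1 - (norm z)\<^sup>2" "2 * \<rho>" "norm (deriv f z)"] by simp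
  moreover have "1 - (norm z)\<^sup>2 > 0" using z by (simp add: abs_square_less_1)
  ultimately show ?thesis by (simp add: field_simps)
qed

text \<open>The Cayley transform \<open>g\<close> of \<open>Q\<close> maps into the disc and
  vanishes at 0, so that \<open>norm (g z) \<le> norm z\<close> by the Schwarz lemma; solving for
  \<open>Q z\<close> gives the bound.\<close>

lemma pos_Re_growth:
  assumes Q: "Q holomorphic_on unit_disc" and pos: "\<And>z. z \<in> unit_disc \<Longrightarrow> 0 < Re (Q z)"
    and z: "z \<in> unit_disc"
  shows "norm (Q z) \<le> 2 * norm (Q 0) / (1 - norm z)"
proof -
  define q where "q = Q 0"
  have q: "0 < Re q" using pos[of 0] by (simp add: q_def)
  define g where "g = (\<lambda>z. (Q z - q) / (Q z + cnj q))"
  have ne: "Q z + cnj q \<noteq> 0" if "z \<in> unit_disc" for z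
    using pos[OF that] q by (auto simp: complex_eq_iff)
  have "g holomorphic_on unit_disc"
    unfolding g_def using ne Q by (intro holomorphic_intros) auto
  moreover have "norm (g z) < 1" if "norm z < 1" for z
  proof -
    have "(norm (Q z + cnj q))\<^sup>2 - (norm (Q z - q))\<^sup>2 = 4 * Re (Q z) * Re q"
      unfolding cmod_power2 by (simp add: power2_eq_square algebra_simps)
    moreover have "4 * Re (Q z) * Re q > 0"
      using pos[of z] q that by (intro mult_pos_pos) auto
    ultimately have "(norm (Q z - q))\<^sup>2 < (norm (Q z + cnj q))\<^sup>2" by linarith
    then have "norm (Q z - q) < norm (Q z + cnj q)"
      by (rule power2_less_imp_less) simp
    then show ?thesis
      using ne[of z] that by (simp add: g_def norm_divide)
  qed
  moreover have "g 0 = 0" by (simp add: g_def q_def)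
  ultimately have gz: "norm (g z) \<le> norm z"
    using z by (intro Schwarz_Lemma(1)) auto
  have "Q z * (1 - g z) = q + g z * cnj q"
    using ne[OF z] by (simp add: g_def field_simps)
  then have "norm (Q z) * norm (1 - g z) = norm (q + g z * cnj q)"
    by (metis norm_mult)
  also have "\<dots> \<le> norm q + norm (g z) * norm q"
    using norm_triangle_ineq[of q "g z * cnj q"] by (simp add: norm_mult)
  also have "\<dots> \<le> norm q + 1 * norm q"
    using gz z by (intro add_left_mono mult_right_mono) auto
  finally have "norm (Q z) * norm (1 - g z) \<le> 2 * norm q" by simp
  moreover have "1 - norm z \<le> norm (1 - g z)"
    using gz norm_triangle_ineq2[of 1 "g z"] by simp
  ultimately have "norm (Q z) * (1 - norm z) \<le> 2 * norm q"
    using mult_left_mono[of "1 - norm z" "norm (1 - g z)" "norm (Q z)"] by simp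
  then show ?thesis using z by (simp add: q_def field_simps)
qed

lemma norm_cnj_mult_less_one:
  assumes "a \<in> unit_disc" "z \<in> unit_disc"
  shows "norm (cnj a * z) < 1"
  using assms by (simp add: norm_mult) (smt (verit) mult_left_le_one_le norm_ge_zero)

text \<open>This identity splits the weight of \<open>bmoa_integral\<close> into
  \<open>1 - (norm z)\<^sup>2\<close> and a Poisson-type kernel.\<close>

lemma one_minus_norm_disc_aut:
  assumes "a \<in> unit_disc" "z \<in> unit_disc"
  shows "1 - (norm (disc_aut a z))\<^sup>2
    = (1 - (norm a)\<^sup>2) * (1 - (norm z)\<^sup>2) / (norm (1 - cnj a * z))\<^sup>2"
proof -
  have ne: "1 - cnj a * z \<noteq> 0"
    using norm_cnj_mult_less_one[OF assms] by auto
  have "(norm (1 - cnj a * z))\<^sup>2 - (norm (a - z))\<^sup>2 = (1 - (norm a)\<^sup>2) * (1 - (norm z)\<^sup>2)"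
    unfolding cmod_power2 by (simp add: power2_eq_square algebra_simps)
  then show ?thesis
    using ne by (simp add: disc_aut_def norm_divide power_divide field_simps)
qed

text \<open>Only right derivatives are assumed, since the generator gives no direct access to the left
  derivatives of \<open>t \<mapsto> \<phi> t z\<close>.\<close>

lemma right_derivative_bound:
  fixes g :: "real \<Rightarrow> 'a::real_normed_vector"
  assumes T: "0 \<le> T" and cont: "continuous_on {0..T} g"
    and der: "\<And>t. 0 \<le> t \<Longrightarrow> t < T \<Longrightarrow> ((\<lambda>s. (g (t + s) - g t) /\<^sub>R s) \<longlongrightarrow> D t) (at_right 0)"
    and M: "\<And>t. 0 \<le> t \<Longrightarrow> t < T \<Longrightarrow> norm (D t) \<le> M"
  shows "norm (g T - g 0) \<le> M * T"
proof -
  have "norm (g T - g 0) \<le> M * T + e * T" if e: "e > 0" for e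
  proof -
    \<comment> \<open>The slack \<open>e\<close> makes the bound on right difference quotients
      strict, so that it holds on a short interval. \<open>A\<close> collects the times up to which
      the estimate has not failed.\<close>
    define S where "S = {t \<in> {0..T}. norm (g t - g 0) \<le> (M + e) * t}"
    have "closed S"
    proof -
      have "S = {0..T} \<inter> (\<lambda>t. norm (g t - g 0) - (M + e) * t) -` {..0}"
        by (auto simp: S_def)
      moreover have "continuous_on {0..T} (\<lambda>t. norm (g t - g 0) - (M + e) * t)"
        by (intro continuous_intros cont)
      ultimately show ?thesis
        by (simp add: continuous_closed_preimage)
    qed
    define A where "A = {t \<in> {0..T}. {0..t} \<subseteq> S}"
    have A0: "0 \<in> A" using T by (auto simp: A_def S_def)
    have bdd: "bdd_above A" by (rule bdd_aboveI[of _ T]) (simp add: A_def)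
    define \<sigma> where "\<sigma> = Sup A"
    have \<sigma>: "0 \<le> \<sigma>" "\<sigma> \<le> T"
    proof -
      show "0 \<le> \<sigma>" unfolding \<sigma>_def by (rule cSup_upper[OF A0 bdd])
      show "\<sigma> \<le> T" unfolding \<sigma>_def
        by (rule cSup_least) (use A0 in blast, simp add: A_def)
    qed
    have lt: "t \<in> S" if t: "0 \<le> t" "t < \<sigma>" for t
    proof -
      obtain u where "u \<in> A" "t < u"
        using less_cSupE[of t A] t A0 unfolding \<sigma>_def by blast
      then show ?thesis using t by (auto simp: A_def)
    qed
    have \<sigma>S: "\<sigma> \<in> S"
    proof (cases "\<sigma> = 0")
      case True then show ?thesis using T by (auto simp: S_def)
    next
      case False
      then have "\<sigma> \<in> closure {0..<\<sigma>}" using \<sigma> by simp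
      moreover have "closure {0..<\<sigma>} \<subseteq> S"
        using lt \<open>closed S\<close> by (intro closure_minimal) auto
      ultimately show ?thesis by blast
    qed
    have "\<sigma> = T"
    proof (rule ccontr)
      assume "\<sigma> \<noteq> T"
      then have \<sigma>T: "\<sigma> < T" using \<sigma> by simp
      \<comment> \<open>If \<open>\<sigma> < T\<close>, the right derivative at
        \<open>\<sigma>\<close> carries the estimate beyond \<open>\<sigma>\<close>, against its
        choice as supremum.\<close>
      have "\<forall>\<^sub>F s in at_right 0. norm ((g (\<sigma> + s) - g \<sigma>) /\<^sub>R s) < M + e"
        using tendsto_norm[OF der[OF \<sigma>(1) \<sigma>T]] M[OF \<sigma>(1) \<sigma>T] e
        by (intro order_tendstoD(2)) auto
      then obtain d where d: "d > 0" "\<And>s. 0 < s \<Longrightarrow> s < d \<Longrightarrow> norm ((g (\<sigma> + s) - g \<sigma>) /\<^sub>R s) < M + e"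
        by (auto simp: eventually_at_right_field)
      define u where "u = \<sigma> + min (d/2) (T - \<sigma>)"
      have u: "\<sigma> < u" "u \<le> T" using d(1) \<sigma>T by (auto simp: u_def)
      have "t \<in> S" if t: "\<sigma> < t" "t \<le> u" for t
      proof -
        define s where "s = t - \<sigma>"
        have s: "0 < s" "s < d" using t d(1) by (auto simp: s_def u_def)
        have "norm (g (\<sigma> + s) - g \<sigma>) \<le> (M + e) * s"
        proof -
          have "inverse s * norm (g (\<sigma> + s) - g \<sigma>) < M + e"
            using d(2)[OF s] s(1) by simp
          then show ?thesis using s(1) by (simp add: field_simps)
        qed
        moreover have "norm (g \<sigma> - g 0) \<le> (M + e) * \<sigma>" using \<sigma>S by (simp add: S_def)
        ultimately have "norm (g t - g 0) \<le> (M + e) * t"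
          using norm_triangle_ineq[of "g t - g \<sigma>" "g \<sigma> - g 0"] by (simp add: s_def algebra_simps)
        then show ?thesis using t u \<sigma> by (auto simp: S_def)
      qed
      note beyond = this
      have "t \<in> S" if "t \<in> {0..u}" for t
        using that lt[of t] beyond[of t] \<sigma>S by (cases t \<sigma> rule: linorder_cases) simp_all
      then have "{0..u} \<subseteq> S" by (rule subsetI)
      moreover have "u \<in> {0..T}" using u \<sigma> by simp
      ultimately have "u \<in> A" unfolding A_def by (intro CollectI conjI)
      then have "u \<le> \<sigma>" unfolding \<sigma>_def using bdd by (rule cSup_upper)
      then show False using u by simp
    qed
    then show ?thesis using \<sigma>S by (simp add: S_def algebra_simps)
  qed
  note * = this
  show ?thesis
  proof (cases "T = 0")
    case False
    show ?thesis
    proof (rule field_le_epsilon)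
      fix e :: real assume "e > 0"
      then show "norm (g T - g 0) \<le> M * T + e" using *[of "e / T"] T False by simp
    qed
  qed simp
qed

section \<open>A Carleson estimate for functions with positive real part\<close>

text \<open>Cauchy's integral formula in the parameter \<open>t\<close>: the differential of
  \<open>cis (2 * pi * t)\<close> is \<open>2 * pi * \<i> * cis (2 * pi * t)\<close>, which cancels
  the usual constant and leaves a factor \<open>cis (2 * pi * t)\<close>.\<close>

lemma circle_average_Cauchy:
  assumes F: "F holomorphic_on cball 0 1" and w: "norm w < 1"
  shows "((\<lambda>t. F (cis (2 * pi * t)) * cis (2 * pi * t) / (cis (2 * pi * t) - w)) has_integral F w) {0..1}"
proof -
  have "((\<lambda>u. F u / (u - w)) has_contour_integral (2 * of_real pi * \<i> * F w)) (circlepath 0 1)"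
    using Cauchy_integral_circlepath_simple[of F 0 1 w] F w by simp
  then have "((\<lambda>x. F (circlepath 0 1 x) / (circlepath 0 1 x - w)
      * vector_derivative (circlepath 0 1) (at x within {0..1}))
      has_integral (2 * of_real pi * \<i> * F w)) {0..1}"
    by (simp add: has_contour_integral_def)
  from has_integral_divide[OF this, of "2 * of_real pi * \<i>"]
  have "((\<lambda>x. F (circlepath 0 1 x) / (circlepath 0 1 x - w)
      * vector_derivative (circlepath 0 1) (at x within {0..1}) / (2 * of_real pi * \<i>))
      has_integral F w) {0..1}"
    by simp
  moreover have "F (circlepath 0 1 x) / (circlepath 0 1 x - w)
      * vector_derivative (circlepath 0 1) (at x within {0..1}) / (2 * of_real pi * \<i>)
      = F (cis (2 * pi * x)) * cis (2 * pi * x) / (cis (2 * pi * x) - w)" if "x \<in> {0..1}" for x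
  proof -
    have "circlepath 0 1 x = cis (2 * pi * x)"
      by (simp add: circlepath cis_conv_exp mult_ac)
    moreover have "vector_derivative (circlepath 0 1) (at x within {0..1}) = 2 * of_real pi * \<i> * cis (2 * pi * x)"
      using that by (subst vector_derivative_circlepath01) (auto simp: cis_conv_exp mult_ac)
    ultimately show ?thesis by simp
  qed
  ultimately show ?thesis
    by (rule has_integral_eq[rotated])
qed

text \<open>For \<open>norm e = 1\<close>, \<open>e / (e - a * cnj z)\<close> is the reciprocal of
  the conjugate of \<open>1 - cnj a * (e * z)\<close>. Hence Cauchy's formula for
  \<open>F w = H (w * z) / (1 - cnj a * (w * z))\<close> at the point \<open>a * cnj z\<close> has
  the squared modulus in its denominator; real parts give the claim.\<close>

lemma Poisson_average:
  assumes H: "H holomorphic_on unit_disc" and a: "a \<in> unit_disc" and z: "z \<in> unit_disc"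
  shows "((\<lambda>t. Re (H (cis (2 * pi * t) * z)) / (norm (1 - cnj a * (cis (2 * pi * t) * z)))\<^sup>2)
    has_integral Re (H (a * of_real ((norm z)\<^sup>2))) / (1 - (norm a)\<^sup>2 * (norm z)\<^sup>2)) {0..1}"
proof -
  define F where "F = (\<lambda>w. H (w * z) / (1 - cnj a * (w * z)))"
  have in_disc: "w * z \<in> unit_disc" if "norm w \<le> 1" for w
    using that z by (simp add: norm_mult) (smt (verit) mult_left_le_one_le norm_ge_zero)
  have ne: "1 - cnj a * (w * z) \<noteq> 0" if "norm w \<le> 1" for w
    using norm_cnj_mult_less_one[OF a in_disc[OF that]] by auto
  have "(H \<circ> (\<lambda>w. w * z)) holomorphic_on cball 0 1"
    by (rule holomorphic_on_compose_gen[OF _ H]) (use in_disc in \<open>auto intro!: holomorphic_intros\<close>)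
  then have holF: "F holomorphic_on cball 0 1"
    unfolding F_def using ne by (intro holomorphic_intros) (auto simp: o_def)
  have less1: "norm (a * cnj z) < 1"
    using norm_cnj_mult_less_one[OF a z] by (simp add: norm_mult)
  have eq: "F e * e / (e - a * cnj z) = H (e * z) / of_real ((norm (1 - cnj a * (e * z)))\<^sup>2)"
    if e: "norm e = 1" for e
  proof -
    have e1: "e * cnj e = 1" using e complex_norm_square[of e] by simp
    then have "e - a * cnj z = e * cnj (1 - cnj a * (e * z))"
      by (simp add: algebra_simps)
    then have "e / (e - a * cnj z) = 1 / cnj (1 - cnj a * (e * z))"
      using e by auto
    then have "F e * e / (e - a * cnj z) = H (e * z) / ((1 - cnj a * (e * z)) * cnj (1 - cnj a * (e * z)))"
      by (metis F_def times_divide_eq_right divide_divide_eq_left mult.right_neutral)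
    also have "\<dots> = H (e * z) / of_real ((norm (1 - cnj a * (e * z)))\<^sup>2)"
      by (simp only: complex_norm_square[symmetric] of_real_power)
    finally show ?thesis .
  qed
  have val: "F (a * cnj z) = H (a * of_real ((norm z)\<^sup>2)) / of_real (1 - (norm a)\<^sup>2 * (norm z)\<^sup>2)"
    unfolding F_def of_real_diff of_real_mult complex_norm_square by (simp add: mult_ac)
  have "((\<lambda>t. H (cis (2 * pi * t) * z) / of_real ((norm (1 - cnj a * (cis (2 * pi * t) * z)))\<^sup>2))
    has_integral H (a * of_real ((norm z)\<^sup>2)) / of_real (1 - (norm a)\<^sup>2 * (norm z)\<^sup>2)) {0..1}"
    using circle_average_Cauchy[OF holF less1] by (simp add: eq val)
  from has_integral_linear[OF this bounded_linear_Re]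
  show ?thesis unfolding o_def Re_divide_of_real .
qed

text \<open>The weight is radial and Lebesgue measure is rotation invariant, so the other factor may
  be replaced by its mean over all rotations of \<open>z\<close>, which
  \<open>Poisson_average\<close> evaluates.\<close>

lemma nn_integral_Poisson_disc:
  assumes H: "H holomorphic_on unit_disc" and pos: "\<And>z. z \<in> unit_disc \<Longrightarrow> 0 \<le> Re (H z)"
    and a: "a \<in> unit_disc" and W [measurable]: "W \<in> borel_measurable borel"
    and W0: "\<And>u. 0 \<le> W u"
  shows "(\<integral>\<^sup>+z\<in>unit_disc. ennreal (W ((norm z)\<^sup>2) * (Re (H z) / (norm (1 - cnj a * z))\<^sup>2)) \<partial>lborel)
    = (\<integral>\<^sup>+z\<in>unit_disc. ennreal (W ((norm z)\<^sup>2) *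
        (Re (H (a * of_real ((norm z)\<^sup>2))) / (1 - (norm a)\<^sup>2 * (norm z)\<^sup>2))) \<partial>lborel)"
proof -
  \<comment> \<open>The values of \<open>H\<close> off the disc are arbitrary; the cutoff makes the
    integrand measurable on the plane.\<close>
  define R where "R = (\<lambda>z. indicator unit_disc z *\<^sub>R (Re (H z) / (norm (1 - cnj a * z))\<^sup>2))"
  have R [measurable]: "R \<in> borel_measurable borel"
    unfolding R_def
  proof (rule borel_measurable_continuous_on_indicator)
    have "1 - cnj a * z \<noteq> 0" if "z \<in> unit_disc" for z
      using norm_cnj_mult_less_one[OF a that] by auto
    then show "continuous_on unit_disc (\<lambda>z. Re (H z) / (norm (1 - cnj a * z))\<^sup>2)"
      using holomorphic_on_imp_continuous_on[OF H] by (intro continuous_intros) auto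
  qed simp
  define \<Phi> where "\<Phi> = (\<lambda>z. ennreal (W ((norm z)\<^sup>2)) * ennreal (R z))"
  have [measurable]: "\<Phi> \<in> borel_measurable borel"
    unfolding \<Phi>_def by measurable
  have [measurable]: "(\<lambda>t. cis (2 * pi * t)) \<in> borel_measurable borel"
    by (intro borel_measurable_continuous_onI continuous_intros)
  have "(\<integral>\<^sup>+z\<in>unit_disc. ennreal (W ((norm z)\<^sup>2) * (Re (H z) / (norm (1 - cnj a * z))\<^sup>2)) \<partial>lborel)
      = (\<integral>\<^sup>+z. \<Phi> z \<partial>lborel)"
    by (intro nn_integral_cong) (auto simp: \<Phi>_def R_def W0 simp flip: ennreal_mult' split: split_indicator)
  \<comment> \<open>A constant is averaged over an interval of length one, so that a rotation
    depending on \<open>t\<close> can be inserted before the integrals are exchanged.\<close>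
  also have "\<dots> = (\<integral>\<^sup>+t\<in>{0..1::real}. (\<integral>\<^sup>+z. \<Phi> z \<partial>lborel) \<partial>lborel)"
    by (subst nn_integral_cmult_indicator) auto
  also have "\<dots> = (\<integral>\<^sup>+t. (\<integral>\<^sup>+z. \<Phi> (cis (2 * pi * t) * z) * indicator {0..1} t \<partial>lborel) \<partial>lborel)"
    by (intro nn_integral_cong, subst nn_integral_multc)
       (auto simp: nn_integral_complex_rotation)
  also have "\<dots> = (\<integral>\<^sup>+z. (\<integral>\<^sup>+t. \<Phi> (cis (2 * pi * t) * z) * indicator {0..1} t \<partial>lborel) \<partial>lborel)"
    by (rule lborel_pair.Fubini') measurable
  also have "\<dots> = (\<integral>\<^sup>+z\<in>unit_disc. ennreal (W ((norm z)\<^sup>2) *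
        (Re (H (a * of_real ((norm z)\<^sup>2))) / (1 - (norm a)\<^sup>2 * (norm z)\<^sup>2))) \<partial>lborel)"
  proof (intro nn_integral_cong)
    fix z :: complex
    show "(\<integral>\<^sup>+t. \<Phi> (cis (2 * pi * t) * z) * indicator {0..1} t \<partial>lborel) =
      ennreal (W ((norm z)\<^sup>2) * (Re (H (a * of_real ((norm z)\<^sup>2))) / (1 - (norm a)\<^sup>2 * (norm z)\<^sup>2)))
        * indicator unit_disc z"
    proof (cases "z \<in> unit_disc")
      case False
      then have "\<Phi> (cis (2 * pi * t) * z) = 0" for t
        by (simp add: \<Phi>_def R_def norm_mult)
      then show ?thesis using False by simp
    next
      case True
      define r where "r t = Re (H (cis (2 * pi * t) * z)) / (norm (1 - cnj a * (cis (2 * pi * t) * z)))\<^sup>2" for t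
      define I where "I = Re (H (a * of_real ((norm z)\<^sup>2))) / (1 - (norm a)\<^sup>2 * (norm z)\<^sup>2)"
      have rR: "r t = R (cis (2 * pi * t) * z)" for t
        using True by (simp add: r_def R_def norm_mult)
      have r0: "0 \<le> r t" for t
        unfolding r_def using True pos[of "cis (2 * pi * t) * z"] by (simp add: norm_mult)
      have "(\<integral>\<^sup>+t. \<Phi> (cis (2 * pi * t) * z) * indicator {0..1} t \<partial>lborel)
        = (\<integral>\<^sup>+t. ennreal (W ((norm z)\<^sup>2)) * ennreal (indicator {0..1} t * r t) \<partial>lborel)"
        by (intro nn_integral_cong) (auto simp: \<Phi>_def rR norm_mult split: split_indicator)
      also have "\<dots> = ennreal (W ((norm z)\<^sup>2)) * (\<integral>\<^sup>+t. ennreal (indicator {0..1} t * r t) \<partial>lborel)"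
        unfolding rR by (subst nn_integral_cmult) auto
      also have "(\<integral>\<^sup>+t. ennreal (indicator {0..1} t * r t) \<partial>lborel) = ennreal I"
        by (rule nn_integral_has_integral_lebesgue)
           (use Poisson_average[OF H a True] r0 in \<open>simp_all add: r_def I_def\<close>)
      finally show ?thesis using True W0 by (simp add: I_def flip: ennreal_mult')
    qed
  qed
  finally show ?thesis .
qed

text \<open>An antiderivative is explicit:
  \<open>F u = - 2 * sqrt ((1 - u) / (\<delta> + (1 - u)))\<close>. The bound is free of
  \<open>\<delta>\<close>, which makes the Carleson estimate uniform in \<open>a\<close>.\<close>

lemma nn_integral_radial_kernel:
  assumes \<delta>: "0 < \<delta>"
  shows "(\<integral>\<^sup>+u\<in>{0<..<1}. ennreal (\<delta> / (sqrt (1 - u) * sqrt (\<delta> + (1 - u)) * (\<delta> + (1 - u)))) \<partial>lborel) \<le> 2"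
proof -
  define f where "f = (\<lambda>u. \<delta> / (sqrt (1 - u) * sqrt (\<delta> + (1 - u)) * (\<delta> + (1 - u))))"
  define F where "F = (\<lambda>u. - 2 * sqrt ((1 - u) / (\<delta> + (1 - u))))"
  have "(F has_vector_derivative f u) (at u)" if u: "u \<in> {0<..<1}" for u
  proof -
    define x where "x = 1 - u"
    have x: "x > 0" using u by (simp add: x_def)
    have "(F has_real_derivative (\<delta> / (\<delta> + x)\<^sup>2) / sqrt (x / (\<delta> + x))) (at u)"
    proof -
      have "((\<lambda>u. (1 - u) / (\<delta> + (1 - u))) has_real_derivative - \<delta> / (\<delta> + x)\<^sup>2) (at u)"
        using \<delta> x by (auto intro!: derivative_eq_intros simp: x_def power2_eq_square field_simps)
      then have "((\<lambda>u. sqrt ((1 - u) / (\<delta> + (1 - u)))) has_real_derivative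
          inverse (sqrt ((1 - u) / (\<delta> + (1 - u)))) / 2 * (- \<delta> / (\<delta> + x)\<^sup>2)) (at u)"
        using \<delta> x by (intro DERIV_chain2[OF DERIV_real_sqrt]) (simp_all add: x_def)
      from DERIV_cmult[OF this, of "-2"] show ?thesis
        unfolding F_def by (rule DERIV_cong) (simp add: x_def inverse_eq_divide mult.commute)
    qed
    moreover have "(\<delta> / (\<delta> + x)\<^sup>2) / sqrt (x / (\<delta> + x)) = f u"
    proof -
      define y where "y = sqrt (\<delta> + x)"
      have y: "y > 0" "\<delta> + x = y * y" using x \<delta> by (simp_all add: y_def)
      have "sqrt (x / (\<delta> + x)) = sqrt x / y" by (simp add: real_sqrt_divide y_def)
      then show ?thesis
        unfolding f_def x_def[symmetric] y_def[symmetric] using x y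
        by (simp add: power2_eq_square)
    qed
    ultimately show ?thesis
      by (simp add: has_real_derivative_iff_has_vector_derivative)
  qed
  \<comment> \<open>The integrand blows up at \<open>u = 1\<close>, but \<open>F\<close> is
    continuous there, so derivatives in the open interval suffice.\<close>
  moreover have "continuous_on {0..1} F"
    unfolding F_def using \<delta> by (intro continuous_intros) auto
  ultimately have "(f has_integral (F 1 - F 0)) {0..1}"
    by (intro fundamental_theorem_of_calculus_interior) auto
  then have int: "(\<integral>\<^sup>+u. ennreal (indicator {0..1} u * f u) \<partial>lborel) = ennreal (F 1 - F 0)"
    by (intro nn_integral_has_integral_lebesgue) (use \<delta> in \<open>auto simp: f_def\<close>)
  have "(\<integral>\<^sup>+u\<in>{0<..<1}. ennreal (f u) \<partial>lborel) \<le> (\<integral>\<^sup>+u. ennreal (indicator {0..1} u * f u) \<partial>lborel)"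
    by (intro nn_integral_mono) (auto split: split_indicator)
  also have "\<dots> \<le> ennreal 2"
    unfolding int using \<delta> by (intro ennreal_leI) (simp add: F_def)
  finally show ?thesis unfolding f_def by simp
qed

text \<open>Since \<open>sqrt \<bar>Q\<bar> \<le> 2 * Re (csqrt Q)\<close>, the left-hand side is the integral of a positive harmonic function
  against a Poisson-type kernel. Averaging over rotations evaluates it at \<open>a * \<bar>z\<bar>\<^sup>2\<close>, where the growth bound
  for \<open>Q\<close> leaves a radial integral.\<close>

lemma positive_real_part_Carleson:
  assumes Q: "Q holomorphic_on unit_disc" and pos: "\<And>z. z \<in> unit_disc \<Longrightarrow> 0 < Re (Q z)"
    and a: "a \<in> unit_disc"
  shows "(\<integral>\<^sup>+z\<in>unit_disc. ennreal (sqrt (norm (Q z)) / sqrt (1 - (norm z)\<^sup>2)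
      * ((1 - (norm a)\<^sup>2) / (norm (1 - cnj a * z))\<^sup>2)) \<partial>lborel)
    \<le> ennreal (32 * pi * sqrt (norm (Q 0)))"
proof -
  define H where "H = (\<lambda>z. csqrt (Q z))"
  define k where "k = 1 - (norm a)\<^sup>2"
  define \<delta> where "\<delta> = 1 - norm a"
  have \<delta>: "0 < \<delta>" "\<delta> \<le> 1" using a by (simp_all add: \<delta>_def)
  have k: "0 < k" "k \<le> 2 * \<delta>"
  proof -
    have "k = \<delta> * (1 + norm a)" by (simp add: k_def \<delta>_def power2_eq_square algebra_simps)
    also have "\<dots> \<le> \<delta> * 2" using \<delta> a by (intro mult_left_mono) auto
    finally show "k \<le> 2 * \<delta>" by simp
    show "0 < k" using a by (simp add: k_def abs_square_less_1)
  qed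
  \<comment> \<open>The real \<open>sqrt\<close> is negative at negative arguments; the value 0 from
    \<open>u = 1\<close> on keeps \<open>W\<close> nonnegative everywhere.\<close>
  define W where "W = (\<lambda>u::real. if u < 1 then k / sqrt (1 - u) else 0)"
  have [measurable]: "W \<in> borel_measurable borel" unfolding W_def by measurable
  have W0: "0 \<le> W u" for u using k by (simp add: W_def)
  have n1: "(norm z)\<^sup>2 < 1" if "z \<in> unit_disc" for z :: complex
    using that by (simp add: abs_square_less_1)
  have "Q z \<notin> \<real>\<^sub>\<le>\<^sub>0" if "z \<in> unit_disc" for z
    using pos[OF that] by (auto simp: complex_nonpos_Reals_iff)
  then have H: "H holomorphic_on unit_disc"
    unfolding H_def using Q by (intro holomorphic_intros) auto
  have ReH: "sqrt (norm (Q z)) \<le> 2 * Re (H z)" if "z \<in> unit_disc" for z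
  proof -
    \<comment> \<open>The real part of \<open>csqrt (Q z)\<close> is
      \<open>sqrt ((norm (Q z) + Re (Q z)) / 2)\<close>, and \<open>Re (Q z) > 0\<close>.\<close>
    have "sqrt (norm (Q z)) = 2 * sqrt (norm (Q z) / 4)"
      by (simp add: real_sqrt_divide)
    also have "\<dots> \<le> 2 * sqrt ((norm (Q z) + Re (Q z)) / 2)"
      using pos[OF that] by (intro mult_left_mono real_sqrt_le_mono) auto
    finally show ?thesis by (simp add: H_def)
  qed
  have H0: "0 \<le> Re (H z)" if "z \<in> unit_disc" for z
    using order_trans[OF _ ReH[OF that], of 0] by simp
  let ?J = "\<lambda>u. W u * (Re (H (a * of_real u)) / (1 - (norm a)\<^sup>2 * u))"
  let ?K = "\<lambda>u. \<delta> / (sqrt (1 - u) * sqrt (\<delta> + (1 - u)) * (\<delta> + (1 - u)))"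
  have J: "?J u \<le> 8 * sqrt (norm (Q 0)) * ?K u" if u: "0 \<le> u" "u < 1" for u
  proof -
    define x where "x = 1 - u"
    have x: "0 < x" "x \<le> 1" using u by (auto simp: x_def)
    have au: "norm a * u < 1"
      using a u by simp (smt (verit) mult_left_le_one_le norm_ge_zero)
    \<comment> \<open>Both \<open>1 - norm a\<close> and \<open>1 - u\<close> are at most
      \<open>1 - norm a * u\<close>, hence so is their mean.\<close>
    have low: "(\<delta> + x) / 2 \<le> 1 - norm a * u"
    proof -
      have "0 \<le> (\<delta> * (1 - x) + x * (1 - \<delta>)) / 2" using \<delta> x by simp
      also have "\<dots> = 1 - norm a * u - (\<delta> + x) / 2"
        by (simp add: \<delta>_def x_def field_simps)
      finally show ?thesis by (simp only: diff_ge_0_iff_ge)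
    qed
    have "(norm a)\<^sup>2 * u \<le> norm a * u"
      using a u by (intro mult_right_mono) (auto simp: power2_eq_square intro: mult_left_le_one_le)
    then have low2: "(\<delta> + x) / 2 \<le> 1 - (norm a)\<^sup>2 * u" using low by linarith
    have "Re (H (a * of_real u)) \<le> norm (H (a * of_real u))" by (rule complex_Re_le_cmod)
    also have "\<dots> = sqrt (norm (Q (a * of_real u)))" by (simp add: H_def norm_csqrt)
    also have "\<dots> \<le> sqrt (2 * norm (Q 0) / (1 - norm (a * of_real u)))"
      using au u by (intro real_sqrt_le_mono pos_Re_growth[OF Q pos]) (auto simp: norm_mult)
    also have "\<dots> \<le> sqrt (2 * norm (Q 0) / ((\<delta> + x) / 2))"
      using low au u \<delta> x by (intro real_sqrt_le_mono divide_left_mono) (auto simp: norm_mult)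
    also have "\<dots> = 2 * sqrt (norm (Q 0)) / sqrt (\<delta> + x)"
      by (simp add: real_sqrt_divide real_sqrt_mult)
    finally have 1: "Re (H (a * of_real u)) \<le> 2 * sqrt (norm (Q 0)) / sqrt (\<delta> + x)" .
    have "?J u \<le> W u * ((2 * sqrt (norm (Q 0)) / sqrt (\<delta> + x)) / ((\<delta> + x) / 2))"
      using 1 low2 \<delta> x W0 by (intro mult_left_mono frac_le) auto
    also have "\<dots> \<le> (2 * \<delta> / sqrt x) * ((2 * sqrt (norm (Q 0)) / sqrt (\<delta> + x)) / ((\<delta> + x) / 2))"
      using k \<delta> x u by (intro mult_right_mono) (auto simp: W_def x_def intro!: divide_right_mono)
    also have "\<dots> = 8 * sqrt (norm (Q 0)) * ?K u"
      unfolding x_def[symmetric] by (simp add: mult_ac)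
    finally show ?thesis .
  qed
  have [measurable]: "(\<lambda>u. ennreal (?K u)) \<in> borel_measurable borel" by measurable
  have "(\<integral>\<^sup>+z\<in>unit_disc. ennreal (sqrt (norm (Q z)) / sqrt (1 - (norm z)\<^sup>2)
      * ((1 - (norm a)\<^sup>2) / (norm (1 - cnj a * z))\<^sup>2)) \<partial>lborel)
    \<le> (\<integral>\<^sup>+z. 2 * (ennreal (W ((norm z)\<^sup>2) * (Re (H z) / (norm (1 - cnj a * z))\<^sup>2)) * indicator unit_disc z) \<partial>lborel)"
  proof (intro nn_integral_mono)
    fix z :: complex
    have "sqrt (norm (Q z)) / sqrt (1 - (norm z)\<^sup>2) * ((1 - (norm a)\<^sup>2) / (norm (1 - cnj a * z))\<^sup>2)
      \<le> 2 * (W ((norm z)\<^sup>2) * (Re (H z) / (norm (1 - cnj a * z))\<^sup>2))" if z: "z \<in> unit_disc"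
    proof -
      have "sqrt (norm (Q z)) * (k / sqrt (1 - (norm z)\<^sup>2) / (norm (1 - cnj a * z))\<^sup>2)
        \<le> 2 * Re (H z) * (k / sqrt (1 - (norm z)\<^sup>2) / (norm (1 - cnj a * z))\<^sup>2)"
        using n1[OF z] k by (intro mult_right_mono ReH z) auto
      then show ?thesis using n1[OF z] unfolding k_def[symmetric] by (simp add: W_def mult_ac)
    qed
    then show "ennreal (sqrt (norm (Q z)) / sqrt (1 - (norm z)\<^sup>2)
      * ((1 - (norm a)\<^sup>2) / (norm (1 - cnj a * z))\<^sup>2)) * indicator unit_disc z
      \<le> 2 * (ennreal (W ((norm z)\<^sup>2) * (Re (H z) / (norm (1 - cnj a * z))\<^sup>2)) * indicator unit_disc z)"
      by (cases "z \<in> unit_disc")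
         (simp_all add: ennreal_leI flip: ennreal_numeral ennreal_mult')
  qed
  also have "\<dots> = 2 * (\<integral>\<^sup>+z\<in>unit_disc. ennreal (W ((norm z)\<^sup>2) * (Re (H z) / (norm (1 - cnj a * z))\<^sup>2)) \<partial>lborel)"
  proof (rule nn_integral_cmult)
    have "(\<lambda>z. indicator unit_disc z *\<^sub>R Re (H z)) \<in> borel_measurable borel"
      using holomorphic_on_imp_continuous_on[OF H]
      by (intro borel_measurable_continuous_on_indicator continuous_intros) auto
    then have "(\<lambda>z. ennreal (W ((norm z)\<^sup>2) * ((indicator unit_disc z *\<^sub>R Re (H z)) / (norm (1 - cnj a * z))\<^sup>2)))
      \<in> borel_measurable borel" by measurable
    also have "(\<lambda>z. ennreal (W ((norm z)\<^sup>2) * ((indicator unit_disc z *\<^sub>R Re (H z)) / (norm (1 - cnj a * z))\<^sup>2)))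
      = (\<lambda>z. ennreal (W ((norm z)\<^sup>2) * (Re (H z) / (norm (1 - cnj a * z))\<^sup>2)) * indicator unit_disc z)"
      by (auto split: split_indicator)
    finally show "(\<lambda>z. ennreal (W ((norm z)\<^sup>2) * (Re (H z) / (norm (1 - cnj a * z))\<^sup>2)) * indicator unit_disc z)
      \<in> borel_measurable lborel" by simp
  qed
  also have "(\<integral>\<^sup>+z\<in>unit_disc. ennreal (W ((norm z)\<^sup>2) * (Re (H z) / (norm (1 - cnj a * z))\<^sup>2)) \<partial>lborel)
    = (\<integral>\<^sup>+z\<in>unit_disc. ennreal (?J ((norm z)\<^sup>2)) \<partial>lborel)"
    by (rule nn_integral_Poisson_disc) (use H H0 a W0 in auto)
  also have "\<dots> \<le> (\<integral>\<^sup>+z\<in>unit_disc. ennreal (8 * sqrt (norm (Q 0))) * ennreal (?K ((norm z)\<^sup>2)) \<partial>lborel)"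
  proof (intro nn_integral_mono)
    fix z :: complex
    show "ennreal (?J ((norm z)\<^sup>2)) * indicator unit_disc z
      \<le> ennreal (8 * sqrt (norm (Q 0))) * ennreal (?K ((norm z)\<^sup>2)) * indicator unit_disc z"
    proof (cases "z \<in> unit_disc")
      case True
      then have "ennreal (?J ((norm z)\<^sup>2)) \<le> ennreal (8 * sqrt (norm (Q 0)) * ?K ((norm z)\<^sup>2))"
        using n1[OF True] by (intro ennreal_leI J) auto
      also have "\<dots> = ennreal (8 * sqrt (norm (Q 0))) * ennreal (?K ((norm z)\<^sup>2))"
        by (rule ennreal_mult') simp
      finally show ?thesis using True by simp
    qed simp
  qed
  also have "\<dots> = ennreal pi * (\<integral>\<^sup>+u\<in>{0<..<1}. ennreal (8 * sqrt (norm (Q 0))) * ennreal (?K u) \<partial>lborel)"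
    by (rule nn_integral_disc_radial) measurable
  also have "(\<integral>\<^sup>+u\<in>{0<..<1}. ennreal (8 * sqrt (norm (Q 0))) * ennreal (?K u) \<partial>lborel)
    = ennreal (8 * sqrt (norm (Q 0))) * (\<integral>\<^sup>+u\<in>{0<..<1}. ennreal (?K u) \<partial>lborel)"
    unfolding mult.assoc by (rule nn_integral_cmult) measurable
  also have "\<dots> \<le> ennreal (8 * sqrt (norm (Q 0))) * 2"
    by (intro mult_left_mono nn_integral_radial_kernel \<delta>) auto
  finally have "(\<integral>\<^sup>+z\<in>unit_disc. ennreal (sqrt (norm (Q z)) / sqrt (1 - (norm z)\<^sup>2)
      * ((1 - (norm a)\<^sup>2) / (norm (1 - cnj a * z))\<^sup>2)) \<partial>lborel)
    \<le> 2 * (ennreal pi * (ennreal (8 * sqrt (norm (Q 0))) * 2))"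
    by (simp add: mult_left_mono)
  \<comment> \<open>The constant 32 collects 2 from the passage to \<open>Re (H z)\<close>, 8 from
    the pointwise bound \<open>J\<close>, and 2 from the radial integral.\<close>
  also have "\<dots> = ennreal (32 * pi * sqrt (norm (Q 0)))"
    by (simp add: mult_ac flip: ennreal_numeral ennreal_mult')
  finally show ?thesis .
qed

section \<open>Membership in BMOA and VMOA\<close>

lemma emeasure_unit_disc: "emeasure lborel unit_disc = ennreal pi"
  using emeasure_ball[of 1 "0::complex"] by (simp add: unit_ball_vol_2)

lemma nn_integral_area_measure:
  assumes "f \<in> borel_measurable borel"
  shows "(\<integral>\<^sup>+z. f z \<partial>area_measure) = (\<integral>\<^sup>+z\<in>unit_disc. f z \<partial>lborel) / ennreal pi"
  unfolding area_measure_def using assms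
  by (subst nn_integral_uniform_measure) (auto simp only: emeasure_unit_disc sets_lborel measurable_lborel1, auto)

text \<open>With \<open>x = norm (deriv f z)\<close> and \<open>s = 1 - (norm z)\<^sup>2\<close>,
  the density \<open>x powr p * s powr (p - 1)\<close> is \<open>(x * s) powr (p - 1/2)\<close>
  times \<open>sqrt x / sqrt s\<close>. The first factor is controlled by \<open>B\<close>, the
  second by \<open>positive_real_part_Carleson\<close>. As \<open>p \<ge> 1\<close>, the power of
  \<open>B\<close> is positive, so that small \<open>B\<close> gives a small integral.\<close>

lemma bmoa_integral_le:
  assumes p: "1 \<le> p" and Q: "Q holomorphic_on unit_disc" and pos: "\<And>z. z \<in> unit_disc \<Longrightarrow> 0 < Re (Q z)"
    and a: "a \<in> unit_disc" and "0 \<le> C" and "0 \<le> B"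
    and C: "\<And>z. z \<in> unit_disc \<Longrightarrow> norm (deriv f z) \<le> C * norm (Q z)"
    and B: "\<And>z. z \<in> unit_disc \<Longrightarrow> norm (deriv f z) * (1 - (norm z)\<^sup>2) \<le> B"
  shows "bmoa_integral p f a \<le> ennreal (B powr (p - 1/2) * sqrt C * (32 * sqrt (norm (Q 0))))"
proof -
  define k where "k = (\<lambda>z. (1 - (norm a)\<^sup>2) / (norm (1 - cnj a * z))\<^sup>2)"
  define g where "g = (\<lambda>z. sqrt (norm (Q z)) / sqrt (1 - (norm z)\<^sup>2) * k z)"
  define D where "D = B powr (p - 1/2) * sqrt C"
  have D: "0 \<le> D" using \<open>0 \<le> C\<close> by (simp add: D_def)
  have k0: "0 \<le> k z" for z
    using a by (simp add: k_def abs_square_le_1)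
  have le: "norm (deriv f z) powr p * (1 - (norm z)\<^sup>2) powr (p - 2) * (1 - (norm (disc_aut a z))\<^sup>2) \<le> D * g z"
    if z: "z \<in> unit_disc" for z
  proof -
    define x where "x = norm (deriv f z)"
    define s where "s = 1 - (norm z)\<^sup>2"
    have s: "0 < s" using z by (simp add: s_def abs_square_less_1)
    have x0: "0 \<le> x" by (simp add: x_def)
    have xB: "x * s \<le> B" and xC: "x \<le> C * norm (Q z)" using B[OF z] C[OF z] by (simp_all add: x_def s_def)
    have aut: "1 - (norm (disc_aut a z))\<^sup>2 = s * k z"
      using one_minus_norm_disc_aut[OF a z] by (simp add: s_def k_def)
    have "x powr p * s powr (p - 2) * s = (x * s) powr (p - 1/2) * (sqrt x / sqrt s)"
    proof -
      have "x powr p = x powr (p - 1/2) * x powr (1/2)"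
        by (simp flip: powr_add)
      moreover have "s powr (p - 2) * s = s powr (p - 1/2) * s powr (-(1/2))"
      proof -
        have "s powr (p - 2) * s = s powr (p - 2) * s powr 1" using s by simp
        also have "\<dots> = s powr (p - 1/2) * s powr (-(1/2))" by (simp only: powr_add[symmetric]) simp
        finally show ?thesis .
      qed
      moreover have "s powr (-(1/2)) = 1 / sqrt s"
        using s by (simp add: powr_minus powr_half_sqrt inverse_eq_divide)
      moreover have "x powr (1/2) = sqrt x" using x0 by (simp add: powr_half_sqrt)
      moreover have "(x * s) powr (p - 1/2) = x powr (p - 1/2) * s powr (p - 1/2)"
        using s x0 by (simp add: powr_mult)
      ultimately show ?thesis by (simp add: mult.assoc)
    qed
    also have "\<dots> \<le> B powr (p - 1/2) * (sqrt (C * norm (Q z)) / sqrt s)"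
      using x0 s p xB xC \<open>0 \<le> B\<close>
      by (intro mult_mono powr_mono2 divide_right_mono real_sqrt_le_mono) auto
    finally have "x powr p * s powr (p - 2) * s * k z \<le> B powr (p - 1/2) * (sqrt (C * norm (Q z)) / sqrt s) * k z"
      by (rule mult_right_mono) (rule k0)
    then show ?thesis
      unfolding aut g_def D_def x_def[symmetric] s_def[symmetric] by (simp add: real_sqrt_mult mult_ac)
  qed
  define gD where "gD = (\<lambda>z. indicator unit_disc z *\<^sub>R g z)"
  have mg [measurable]: "gD \<in> borel_measurable borel"
    unfolding gD_def
  proof (rule borel_measurable_continuous_on_indicator)
    have "1 - cnj a * z \<noteq> 0" if "z \<in> unit_disc" for z
      using norm_cnj_mult_less_one[OF a that] by auto
    moreover have "(norm z)\<^sup>2 \<noteq> 1" if "z \<in> unit_disc" for z :: complex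
      using that by (simp add: abs_square_less_1 less_imp_neq)
    ultimately show "continuous_on unit_disc g"
      unfolding g_def k_def using holomorphic_on_imp_continuous_on[OF Q]
      by (intro continuous_intros) auto
  qed simp
  have "bmoa_integral p f a \<le> (\<integral>\<^sup>+z. ennreal D * ennreal (gD z) \<partial>area_measure)"
    unfolding bmoa_integral_def
  proof (intro nn_integral_mono)
    fix z :: complex
    show "ennreal (norm (deriv f z) powr p * (1 - (norm z)\<^sup>2) powr (p - 2) * (1 - (norm (disc_aut a z))\<^sup>2))
      * indicator unit_disc z \<le> ennreal D * ennreal (gD z)"
      using ennreal_leI[OF le[of z]] D by (cases "z \<in> unit_disc") (simp_all add: ennreal_mult' gD_def)
  qed
  also have "\<dots> = (\<integral>\<^sup>+z\<in>unit_disc. ennreal D * ennreal (gD z) \<partial>lborel) / ennreal pi"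
    by (rule nn_integral_area_measure) measurable
  also have "(\<integral>\<^sup>+z\<in>unit_disc. ennreal D * ennreal (gD z) \<partial>lborel)
    = (\<integral>\<^sup>+z. ennreal D * ennreal (gD z) \<partial>lborel)"
    by (intro nn_integral_cong) (auto simp: gD_def split: split_indicator)
  also have "\<dots> = ennreal D * (\<integral>\<^sup>+z. ennreal (gD z) \<partial>lborel)"
    by (rule nn_integral_cmult) measurable
  also have "(\<integral>\<^sup>+z. ennreal (gD z) \<partial>lborel) = (\<integral>\<^sup>+z\<in>unit_disc. ennreal (g z) \<partial>lborel)"
    by (intro nn_integral_cong) (auto simp: gD_def split: split_indicator)
  also have "ennreal D * (\<integral>\<^sup>+z\<in>unit_disc. ennreal (g z) \<partial>lborel) / ennreal pi
    \<le> ennreal D * ennreal (32 * pi * sqrt (norm (Q 0))) / ennreal pi"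
    unfolding g_def k_def
    by (intro divide_right_mono_ennreal mult_left_mono positive_real_part_Carleson Q pos a) auto
  also have "\<dots> = ennreal (D * (32 * sqrt (norm (Q 0))))"
    using D by (simp add: divide_ennreal flip: ennreal_mult')
  finally show ?thesis by (simp add: D_def)
qed

lemma bmoa_norm_le:
  assumes p: "1 \<le> p" and "0 \<le> B" and "norm (f 0) powr p \<le> A"
    and "\<And>a. a \<in> unit_disc \<Longrightarrow> bmoa_integral p f a \<le> ennreal B"
  shows "bmoa_norm p f \<le> ennreal ((A + B) powr (1 / p))"
proof -
  have A: "0 \<le> A" using assms(3) powr_ge_zero order_trans by blast
  have "bmoa_norm_power p f \<le> ennreal A + ennreal B"
    unfolding bmoa_norm_power_def using assms by (intro add_mono ennreal_leI SUP_least) auto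
  then have le: "bmoa_norm_power p f \<le> ennreal (A + B)"
    using A \<open>0 \<le> B\<close> by simp
  then have "enn2real (bmoa_norm_power p f) \<le> A + B"
    using A \<open>0 \<le> B\<close> by (intro enn2real_leI) auto
  then have "enn2real (bmoa_norm_power p f) powr (1 / p) \<le> (A + B) powr (1 / p)"
    using p by (intro powr_mono2) auto
  moreover have "bmoa_norm_power p f \<noteq> \<infinity>"
    using le by (auto simp: top_unique)
  ultimately show ?thesis
    unfolding bmoa_norm_def by (simp add: ennreal_leI)
qed

text \<open>By \<open>pos_Re_growth\<close>, domination by \<open>C * norm (Q z)\<close> already
  implies the bound \<open>B\<close> required in \<open>bmoa_integral_le\<close>, with
  \<open>B = 4 * C * norm (Q 0)\<close>.\<close>

lemma BMOA_if_deriv_dominated: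
  assumes p: "1 \<le> p" and f: "f holomorphic_on unit_disc"
    and Q: "Q holomorphic_on unit_disc" and pos: "\<And>z. z \<in> unit_disc \<Longrightarrow> 0 < Re (Q z)"
    and "0 \<le> C" and C: "\<And>z. z \<in> unit_disc \<Longrightarrow> norm (deriv f z) \<le> C * norm (Q z)"
  shows "f \<in> BMOA p"
proof -
  define B where "B = 4 * C * norm (Q 0)"
  have B: "norm (deriv f z) * (1 - (norm z)\<^sup>2) \<le> B" if z: "z \<in> unit_disc" for z
  proof -
    have nz: "norm z < 1" using z by simp
    have "norm (deriv f z) \<le> C * (2 * norm (Q 0) / (1 - norm z))"
      using C[OF z] mult_left_mono[OF pos_Re_growth[OF Q pos z] \<open>0 \<le> C\<close>] by linarith
    then have "norm (deriv f z) * (1 - (norm z)\<^sup>2) \<le> C * (2 * norm (Q 0) / (1 - norm z)) * (1 - (norm z)\<^sup>2)"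
      using nz by (intro mult_right_mono) (auto simp: abs_square_le_1)
    also have "\<dots> = C * (2 * norm (Q 0)) * (1 + norm z)"
      using nz by (simp add: field_simps power2_eq_square)
    also have "\<dots> \<le> C * (2 * norm (Q 0)) * 2"
      using nz \<open>0 \<le> C\<close> by (intro mult_left_mono) auto
    finally show ?thesis by (simp add: B_def)
  qed
  have B0: "0 \<le> B" using \<open>0 \<le> C\<close> by (simp add: B_def)
  have "bmoa_norm p f \<le> ennreal ((norm (f 0) powr p + B powr (p - 1/2) * sqrt C * (32 * sqrt (norm (Q 0)))) powr (1 / p))"
  proof (rule bmoa_norm_le[OF p _ order_refl])
    show "0 \<le> B powr (p - 1/2) * sqrt C * (32 * sqrt (norm (Q 0)))"
      using \<open>0 \<le> C\<close> by simp
    show "bmoa_integral p f a \<le> ennreal (B powr (p - 1/2) * sqrt C * (32 * sqrt (norm (Q 0))))"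
      if "a \<in> unit_disc" for a
      by (rule bmoa_integral_le[OF p Q pos that \<open>0 \<le> C\<close> B0 C B])
  qed
  also have "\<dots> < \<infinity>" by simp
  finally have "bmoa_norm p f < \<infinity>" .
  then show ?thesis using f unfolding BMOA_def by simp
qed

text \<open>The logarithm separates the two spaces, which will exclude the trivial semigroup. Its
  derivative has the modulus of \<open>1 / (1 - z)\<close>, a function with positive real part. For
  \<open>a = r\<close> close to 1, the disc of radius \<open>(1 - r) / 2\<close> about
  \<open>a\<close> alone contributes a fixed positive amount to the integral.\<close>

lemma log_BMOA:
  assumes p: "1 \<le> p"
  shows "(\<lambda>z. Ln (1 - z)) \<in> BMOA p"
    and log_not_VMOA: "(\<lambda>z. Ln (1 - z)) \<notin> VMOA p"
proof -
  let ?f = "\<lambda>z::complex. Ln (1 - z)"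
  have nonneg: "1 - z \<notin> \<real>\<^sub>\<le>\<^sub>0" "0 < Re (1 - z)" "1 - z \<noteq> 0" if "z \<in> unit_disc" for z
    using that complex_Re_le_cmod[of z] by (auto simp: complex_nonpos_Reals_iff)
  have der: "deriv ?f z = - (1 / (1 - z))" if "z \<in> unit_disc" for z
  proof -
    have "((\<lambda>z. 1 - z) has_field_derivative - 1) (at z)"
      by (auto intro!: derivative_eq_intros)
    from DERIV_chain2[OF has_field_derivative_Ln[OF nonneg(1)[OF that]] this] show ?thesis
      by (simp add: DERIV_imp_deriv inverse_eq_divide)
  qed
  show "?f \<in> BMOA p"
  proof (rule BMOA_if_deriv_dominated[OF p, where Q = "\<lambda>z. 1 / (1 - z)" and C = 1])
    show "?f holomorphic_on unit_disc" "(\<lambda>z. 1 / (1 - z)) holomorphic_on unit_disc"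
      using nonneg by (auto intro!: holomorphic_intros)
    show "0 < Re (1 / (1 - z))" if "z \<in> unit_disc" for z
    proof -
      have "Re (1 / (1 - z)) = Re (1 - z) / (norm (1 - z))\<^sup>2"
        unfolding cmod_power2 by (simp add: Re_divide)
      also have "\<dots> > 0" using nonneg[OF that] by (intro divide_pos_pos) auto
      finally show ?thesis .
    qed
  qed (simp_all add: der)
  show "?f \<notin> VMOA p"
  proof
    \<comment> \<open>On \<open>ball a (d / 2)\<close> the integrand is at least
      \<open>4 * c / d\<^sup>2\<close>, from \<open>norm (1 - z) \<le> 2 * d\<close>,
      \<open>s \<ge> d / 2\<close> and \<open>norm (1 - cnj a * z) \<le> 3 * d\<close>; the
      normalized area of this ball is \<open>d\<^sup>2 / 4\<close>.\<close>
    define c where "c = (1/2) powr (2 * p - 1) / 36"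
    have c: "0 < c" by (simp add: c_def)
    assume "?f \<in> VMOA p"
    then have lim: "(bmoa_integral p ?f \<longlongrightarrow> 0) (filtercomap norm (at_left 1))"
      by (simp add: VMOA_def)
    have "\<forall>\<^sub>F a in filtercomap norm (at_left 1). bmoa_integral p ?f a < ennreal c"
      using c by (intro order_tendstoD(2)[OF lim]) simp
    then obtain P where P: "eventually P (at_left (1::real))" "\<And>a. P (norm a) \<Longrightarrow> bmoa_integral p ?f a < ennreal c"
      unfolding eventually_filtercomap by blast
    have "\<forall>\<^sub>F r in at_left (1::real). P r \<and> r \<in> {0<..<1}"
      using P(1) eventually_at_left_real[of 0 1] by (intro eventually_conj) auto
    then obtain r where r: "P r" "0 < r" "r < 1"
      using eventually_happens[of "\<lambda>r. P r \<and> r \<in> {0<..<1}" "at_left (1::real)"] by auto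
    \<comment> \<open>The limit sees only the modulus of \<open>a\<close>, so the point may be taken
      on the radius towards the singularity 1.\<close>
    define a where "a = complex_of_real r"
    define d where "d = 1 - r"
    have a: "a \<in> unit_disc" "norm a = r" using r by (simp_all add: a_def)
    have d: "0 < d" "d < 1" using r by (simp_all add: d_def)
    have sub: "ball a (d / 2) \<subseteq> unit_disc"
    proof
      fix z assume "z \<in> ball a (d / 2)"
      then have "norm (z - a) < d / 2" by (simp add: dist_norm norm_minus_commute)
      then show "z \<in> unit_disc"
        using norm_triangle_ineq[of a "z - a"] a d by (simp add: d_def)
    qed
    have low: "ennreal (4 * c / d\<^sup>2) * indicator (ball a (d/2)) z \<le>
      ennreal (norm (deriv ?f z) powr p * (1 - (norm z)\<^sup>2) powr (p - 2) * (1 - (norm (disc_aut a z))\<^sup>2))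
      * indicator unit_disc z" for z
    proof (cases "z \<in> ball a (d/2)")
      case True
      then have z: "z \<in> unit_disc" using sub by blast
      have za: "norm (z - a) < d / 2" using True by (simp add: dist_norm norm_minus_commute)
      have nz: "norm z < 1 - d / 2"
      proof -
        have "norm z \<le> norm a + norm (z - a)" using norm_triangle_ineq[of a "z - a"] by simp
        then show ?thesis using za unfolding a(2) d_def by (simp add: field_simps)
      qed
      define s where "s = 1 - (norm z)\<^sup>2"
      have "(norm z)\<^sup>2 \<le> norm z" using z by (simp add: power2_eq_square mult_left_le_one_le)
      then have s: "d / 2 \<le> s" using nz by (simp add: s_def)
      have "1 - a = of_real d" by (simp add: a_def d_def)
      then have one_a: "norm (1 - a) = d" using d by simp
      have z1: "norm (1 - z) \<le> 2 * d"
        using norm_triangle_ineq4[of "1 - a" "z - a"] za d one_a by simp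
      have z1': "0 < norm (1 - z)" using nonneg[OF z] by simp
      have "norm (1 - cnj a * z) \<le> norm (1 - z) + norm ((1 - a) * z)"
        using norm_triangle_ineq[of "1 - z" "(1 - a) * z"] by (simp add: a_def algebra_simps)
      also have "\<dots> \<le> 2 * d + d * 1"
        using z1 z one_a d unfolding norm_mult by (intro add_mono mult_mono) auto
      finally have az: "norm (1 - cnj a * z) \<le> 3 * d" by simp
      have az': "0 < norm (1 - cnj a * z)" using norm_cnj_mult_less_one[OF a(1) z] by auto
      have "1 - (norm a)\<^sup>2 = d * (1 + r)" using a by (simp add: d_def power2_eq_square algebra_simps)
      then have ka: "d \<le> 1 - (norm a)\<^sup>2" using d r by simp
      have "4 * c / d\<^sup>2 = (1 / (2 * d)) powr p * (d / 2) powr (p - 1) * (d / (3 * d)\<^sup>2)"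
      proof -
        have "(1 / (2 * d)) powr p * (d / 2) powr (p - 1) = (1/2) powr (2 * p - 1) * (d powr (- p) * d powr (p - 1))"
        proof -
          have "(1 / (2 * d)) powr p = (1/2) powr p * d powr (- p)"
            using d by (simp add: powr_mult powr_divide powr_minus inverse_eq_divide)
          moreover have "(d / 2) powr (p - 1) = (1/2) powr (p - 1) * d powr (p - 1)"
            using d powr_mult[of "1/2" d "p - 1"] by simp
          moreover have "(1/2) powr (2 * p - 1) = (1/2) powr p * (1/2 :: real) powr (p - 1)"
            by (simp flip: powr_add)
          ultimately show ?thesis by (simp only: mult_ac)
        qed
        also have "d powr (- p) * d powr (p - 1) = 1 / d"
        proof -
          have "d powr (- p) * d powr (p - 1) = d powr (- 1)" by (simp flip: powr_add)
          then show ?thesis using d by (simp add: powr_minus inverse_eq_divide)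
        qed
        finally show ?thesis using d by (simp add: c_def power2_eq_square)
      qed
      also have "\<dots> \<le> (1 / norm (1 - z)) powr p * s powr (p - 1) * ((1 - (norm a)\<^sup>2) / (norm (1 - cnj a * z))\<^sup>2)"
      proof (intro mult_mono)
        show "(1 / (2 * d)) powr p \<le> (1 / norm (1 - z)) powr p"
        proof (rule powr_mono2)
          show "1 / (2 * d) \<le> 1 / norm (1 - z)" using z1 z1' by (intro frac_le) simp_all
        qed (use d(1) p in simp_all)
        show "(d / 2) powr (p - 1) \<le> s powr (p - 1)"
          using d p s by (intro powr_mono2) simp_all
        show "d / (3 * d)\<^sup>2 \<le> (1 - (norm a)\<^sup>2) / (norm (1 - cnj a * z))\<^sup>2"
        proof (rule frac_le)
          show "0 \<le> 1 - (norm a)\<^sup>2" using ka d(1) by linarith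
          show "(norm (1 - cnj a * z))\<^sup>2 \<le> (3 * d)\<^sup>2" using az by (intro power_mono) simp_all
        qed (use ka az' in simp_all)
      qed (use d in simp_all)
      also have "s powr (p - 1) = s powr (p - 2) * s"
        using s d powr_mult_base[of s "p - 2"] by (simp add: mult.commute)
      finally have "4 * c / d\<^sup>2 \<le> norm (deriv ?f z) powr p * s powr (p - 2) * (1 - (norm (disc_aut a z))\<^sup>2)"
        using one_minus_norm_disc_aut[OF a(1) z] by (simp add: der[OF z] norm_divide s_def mult_ac)
      then show ?thesis using True z by (simp add: s_def ennreal_leI)
    qed simp
    have "ennreal c = ennreal (4 * c / d\<^sup>2) * ennreal (pi * (d / 2)\<^sup>2) / ennreal pi"
      using c d by (simp add: divide_ennreal power2_eq_square flip: ennreal_mult)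
    also have "ennreal (pi * (d / 2)\<^sup>2) = emeasure lborel (ball a (d / 2))"
      using d by (simp add: emeasure_ball unit_ball_vol_2)
    also have "ennreal (4 * c / d\<^sup>2) * emeasure lborel (ball a (d / 2))
      = (\<integral>\<^sup>+z. ennreal (4 * c / d\<^sup>2) * indicator (ball a (d/2)) z \<partial>lborel)"
      by (simp add: nn_integral_cmult_indicator)
    also have "\<dots> = (\<integral>\<^sup>+z\<in>unit_disc. ennreal (4 * c / d\<^sup>2) * indicator (ball a (d/2)) z \<partial>lborel)"
      using sub by (intro nn_integral_cong) (auto split: split_indicator)
    also have "\<dots> / ennreal pi = (\<integral>\<^sup>+z. ennreal (4 * c / d\<^sup>2) * indicator (ball a (d/2)) z \<partial>area_measure)"
      by (intro nn_integral_area_measure[symmetric] borel_measurable_times_ennreal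
          borel_measurable_const borel_measurable_indicator) simp
    also have "\<dots> \<le> bmoa_integral p ?f a"
      unfolding bmoa_integral_def by (intro nn_integral_mono low)
    also have "\<dots> < ennreal c"
      using P(2)[of a] r a by simp
    finally show False by simp
  qed
qed

section \<open>Semigroups and their generators\<close>

lemma disc_semigroup_limit_zero:
  assumes "disc_semigroup \<phi>" "z \<in> unit_disc"
  shows "((\<lambda>s. \<phi> s z) \<longlongrightarrow> z) (at_right 0)"
proof -
  have "uniform_limit {z} \<phi> (\<phi> 0) (at_right 0)"
    using assms unfolding disc_semigroup_def by (metis compact_sing empty_subsetI insert_subset)
  then have "((\<lambda>s. \<phi> s z) \<longlongrightarrow> \<phi> 0 z) (at_right 0)"
    by (rule tendsto_uniform_limitI) simp
  then show ?thesis using assms by (simp add: disc_semigroup_def)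
qed

lemma disc_semigroup_self_map:
  assumes "disc_semigroup \<phi>" "0 \<le> t"
  shows "\<phi> t holomorphic_on unit_disc" and "\<phi> t ` unit_disc \<subseteq> unit_disc"
    and "z \<in> unit_disc \<Longrightarrow> \<phi> t z \<in> unit_disc"
  using assms unfolding disc_semigroup_def by blast+

lemma disc_semigroup_comp:
  assumes "disc_semigroup \<phi>" "0 \<le> t" "0 \<le> s" "z \<in> unit_disc"
  shows "\<phi> t (\<phi> s z) = \<phi> (t + s) z"
  using assms unfolding disc_semigroup_def by blast

text \<open>The Lipschitz bound at \<open>z\<close> is the same for all self-maps, so continuity at
  time 0 yields one modulus of continuity for all times, which gives left continuity as
  well.\<close>

lemma disc_semigroup_continuous:
  assumes \<phi>: "disc_semigroup \<phi>" and z: "z \<in> unit_disc"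
  shows "continuous_on {0..} (\<lambda>t. \<phi> t z)"
proof (unfold continuous_on_iff, intro ballI allI impI)
  fix t e :: real assume t: "t \<in> {0..}" and e: "0 < e"
  have z1: "0 < 1 - norm z" using z by simp
  have "\<forall>\<^sub>F s in at_right 0. dist (\<phi> s z) z < e * (1 - norm z) / 2"
    using disc_semigroup_limit_zero[OF \<phi> z] e z1 by (intro tendstoD) simp_all
  then obtain d where d: "d > 0" "\<And>s. 0 < s \<Longrightarrow> s < d \<Longrightarrow> dist (\<phi> s z) z < e * (1 - norm z) / 2"
    by (auto simp: eventually_at_right_field)
  have step: "norm (\<phi> (u + s) z - \<phi> u z) < e" if "0 \<le> u" "0 < s" "s < d" for u s
  proof -
    have "norm (\<phi> u (\<phi> s z) - \<phi> u z) \<le> 2 * norm (\<phi> s z - z) / (1 - norm z)"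
      using that z by (intro disc_self_map_lipschitz disc_semigroup_self_map[OF \<phi>]) auto
    also have "\<dots> < e"
      using d(2)[OF that(2,3)] z1 by (simp add: dist_norm field_simps)
    finally show ?thesis
      using disc_semigroup_comp[OF \<phi>, of u s z] that z by simp
  qed
  have "dist (\<phi> u z) (\<phi> t z) < e" if u: "u \<in> {0..}" "dist u t < d" for u
  proof (cases u t rule: linorder_cases)
    case less
    then show ?thesis
      using step[of u "t - u"] u by (simp add: dist_norm norm_minus_commute)
  next
    case equal
    then show ?thesis using e by simp
  next
    case greater
    then show ?thesis
      using step[of t "u - t"] u t by (simp add: dist_norm)
  qed
  then show "\<exists>d>0. \<forall>u\<in>{0..}. dist u t < d \<longrightarrow> dist (\<phi> u z) (\<phi> t z) < e"
    using d(1) by blast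
qed

text \<open>Caratheodory's form of the derivative avoids dividing by \<open>\<phi> s w - w\<close>,
  which may vanish.\<close>

lemma generator_chain_rule:
  assumes \<phi>: "disc_semigroup \<phi>" and G: "infinitesimal_generator \<phi> G"
    and F: "F holomorphic_on unit_disc" and w: "w \<in> unit_disc"
  shows "((\<lambda>s. (F (\<phi> s w) - F w) / of_real s) \<longlongrightarrow> deriv F w * G w) (at_right 0)"
proof -
  have "(F has_field_derivative deriv F w) (at w)"
    using F w by (intro holomorphic_derivI[of F unit_disc]) auto
  then obtain q where q: "\<And>z. F z - F w = q z * (z - w)" "isCont q w" "q w = deriv F w"
    unfolding CARAT_DERIV by blast
  have "((\<lambda>s. q (\<phi> s w) * ((\<phi> s w - w) / of_real s)) \<longlongrightarrow> q w * G w) (at_right 0)"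
  proof (rule tendsto_mult)
    show "((\<lambda>s. q (\<phi> s w)) \<longlongrightarrow> q w) (at_right 0)"
      by (rule isCont_tendsto_compose[OF q(2) disc_semigroup_limit_zero[OF \<phi> w]])
    show "((\<lambda>s. (\<phi> s w - w) / of_real s) \<longlongrightarrow> G w) (at_right 0)"
      using G w unfolding infinitesimal_generator_def by blast
  qed
  then show ?thesis by (simp add: q)
qed

text \<open>Both sides are the right derivative at \<open>s = 0\<close> of
  \<open>\<phi> (t + s) z\<close>, split once as \<open>\<phi> t (\<phi> s z)\<close> and once as
  \<open>\<phi> s (\<phi> t z)\<close>.\<close>

lemma generator_commutes:
  assumes \<phi>: "disc_semigroup \<phi>" and G: "infinitesimal_generator \<phi> G"
    and t: "0 \<le> t" and z: "z \<in> unit_disc"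
  shows "deriv (\<phi> t) z * G z = G (\<phi> t z)"
proof (rule tendsto_unique)
  show "((\<lambda>s. (\<phi> t (\<phi> s z) - \<phi> t z) / of_real s) \<longlongrightarrow> deriv (\<phi> t) z * G z) (at_right 0)"
    by (rule generator_chain_rule[OF \<phi> G disc_semigroup_self_map(1)[OF \<phi> t] z])
  have "((\<lambda>s. (\<phi> s (\<phi> t z) - \<phi> t z) / of_real s) \<longlongrightarrow> G (\<phi> t z)) (at_right 0)"
    using G disc_semigroup_self_map(3)[OF \<phi> t z] unfolding infinitesimal_generator_def by blast
  moreover have "\<forall>\<^sub>F s in at_right 0. (\<phi> s (\<phi> t z) - \<phi> t z) / of_real s = (\<phi> t (\<phi> s z) - \<phi> t z) / of_real s"
    using eventually_at_right_less[of 0]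
  proof eventually_elim
    case (elim s)
    then show ?case
      using disc_semigroup_comp[OF \<phi> _ t z, of s] disc_semigroup_comp[OF \<phi> t _ z, of s]
      by (simp add: add.commute)
  qed
  ultimately show "((\<lambda>s. (\<phi> t (\<phi> s z) - \<phi> t z) / of_real s) \<longlongrightarrow> G (\<phi> t z)) (at_right 0)"
    by (rule Lim_transform_eventually)
qed simp

text \<open>Along an orbit the right derivative of \<open>F\<close> is \<open>deriv F * G\<close>,
  so \<open>right_derivative_bound\<close> applies. For a primitive with
  \<open>deriv F z * G z = z - b\<close> this gives the bound \<open>2 * t\<close>; for the identity
  and \<open>G = 0\<close> it shows that the semigroup is trivial.\<close>

lemma semigroup_orbit_bound:
  assumes \<phi>: "disc_semigroup \<phi>" and G: "infinitesimal_generator \<phi> G"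
    and F: "F holomorphic_on unit_disc" and M: "\<And>w. w \<in> unit_disc \<Longrightarrow> norm (deriv F w * G w) \<le> M"
    and t: "0 \<le> t" and z: "z \<in> unit_disc"
  shows "norm (F (\<phi> t z) - F z) \<le> M * t"
proof -
  have "norm (F (\<phi> t z) - F (\<phi> 0 z)) \<le> M * t"
  proof (rule right_derivative_bound[OF t])
    have "continuous_on {0..t} (\<lambda>t. \<phi> t z)"
      using disc_semigroup_continuous[OF \<phi> z] by (rule continuous_on_subset) auto
    then show "continuous_on {0..t} (\<lambda>t. F (\<phi> t z))"
      by (rule continuous_on_compose2[OF holomorphic_on_imp_continuous_on[OF F]])
         (use disc_semigroup_self_map(3)[OF \<phi> _ z] in auto)
    fix u :: real assume u: "0 \<le> u"
    have uz: "\<phi> u z \<in> unit_disc" using disc_semigroup_self_map(3)[OF \<phi> u z] .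
    show "norm (deriv F (\<phi> u z) * G (\<phi> u z)) \<le> M" by (rule M[OF uz])
    have "\<forall>\<^sub>F s in at_right 0. (F (\<phi> s (\<phi> u z)) - F (\<phi> u z)) / of_real s = (F (\<phi> (u + s) z) - F (\<phi> u z)) /\<^sub>R s"
      using eventually_at_right_less[of 0]
    proof eventually_elim
      case (elim s)
      then show ?case
        using disc_semigroup_comp[OF \<phi> _ u z, of s]
        by (simp add: add.commute scaleR_conv_of_real inverse_eq_divide)
    qed
    then show "((\<lambda>s. (F (\<phi> (u + s) z) - F (\<phi> u z)) /\<^sub>R s) \<longlongrightarrow> deriv F (\<phi> u z) * G (\<phi> u z)) (at_right 0)"
      using generator_chain_rule[OF \<phi> G F uz] by (rule Lim_transform_eventually[rotated])
  qed
  moreover have "\<phi> 0 z = z" using \<phi> z by (simp add: disc_semigroup_def)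
  ultimately show ?thesis by simp
qed

text \<open>Cauchy's estimate turns the bound \<open>2 * t\<close> into \<open>B = 4 * t\<close> for
  \<open>bmoa_integral_le\<close>, while \<open>C\<close> and \<open>Q\<close> do not depend on
  \<open>t\<close>. The integrals are then at most a constant times
  \<open>(4 * t) powr (p - 1/2)\<close>.\<close>

lemma bmoa_norm_tendsto_zero:
  assumes p: "1 \<le> p" and Q: "Q holomorphic_on unit_disc" and pos: "\<And>z. z \<in> unit_disc \<Longrightarrow> 0 < Re (Q z)"
    and "0 \<le> C" and hol: "\<And>t. 0 < t \<Longrightarrow> h t holomorphic_on unit_disc"
    and small: "\<And>t z. 0 < t \<Longrightarrow> z \<in> unit_disc \<Longrightarrow> norm (h t z) \<le> 2 * t"
    and C: "\<And>t z. 0 < t \<Longrightarrow> z \<in> unit_disc \<Longrightarrow> norm (deriv (h t) z) \<le> C * norm (Q z)"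
  shows "((\<lambda>t. bmoa_norm p (h t)) \<longlongrightarrow> 0) (at_right 0)"
proof -
  define K where "K = sqrt C * (32 * sqrt (norm (Q 0)))"
  define R where "R = (\<lambda>t. ((2 * t) powr p + (4 * t) powr (p - 1/2) * K) powr (1 / p))"
  have K: "0 \<le> K" using \<open>0 \<le> C\<close> by (simp add: K_def)
  have le: "bmoa_norm p (h t) \<le> ennreal (R t)" if t: "0 < t" for t
    unfolding R_def
  proof (rule bmoa_norm_le[OF p])
    show "0 \<le> (4 * t) powr (p - 1/2) * K" using K by simp
    show "norm (h t 0) powr p \<le> (2 * t) powr p"
      using small[OF t, of 0] p by (intro powr_mono2) auto
    fix a assume a: "a \<in> unit_disc"
    have "norm (deriv (h t) z) * (1 - (norm z)\<^sup>2) \<le> 4 * t" if z: "z \<in> unit_disc" for z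
    proof -
      have "0 < 1 - (norm z)\<^sup>2" using z by (simp add: abs_square_less_1)
      moreover have "norm (deriv (h t) z) \<le> 2 * (2 * t) / (1 - (norm z)\<^sup>2)"
        by (rule disc_deriv_bound[OF hol[OF t] small[OF t] z])
      ultimately show ?thesis by (simp add: field_simps)
    qed
    then show "bmoa_integral p (h t) a \<le> ennreal ((4 * t) powr (p - 1/2) * K)"
      unfolding K_def mult.assoc[symmetric]
      using bmoa_integral_le[OF p Q pos a \<open>0 \<le> C\<close> _ C[OF t], of "4 * t"] t
      by (simp add: mult.assoc)
  qed
  have "(R \<longlongrightarrow> 0) (at_right 0)"
    unfolding R_def
  proof (rule tendsto_zero_powrI)
    have m: "((\<lambda>t. (c * t) powr q) \<longlongrightarrow> 0) (at_right 0)" if "0 < c" "0 < q" for c q :: real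
    proof (rule tendsto_zero_powrI[OF _ tendsto_const _ that(2)])
      show "((\<lambda>t. c * t) \<longlongrightarrow> 0) (at_right 0)"
        by (rule tendsto_eq_intros | simp)+
      show "\<forall>\<^sub>F t in at_right 0. 0 \<le> c * t"
        using eventually_at_right_less[of 0] by eventually_elim (use that in simp)
    qed
    have "((\<lambda>t. (2 * t) powr p + (4 * t) powr (p - 1/2) * K) \<longlongrightarrow> 0 + 0 * K) (at_right 0)"
      using p by (intro tendsto_intros m) auto
    then show "((\<lambda>t. (2 * t) powr p + (4 * t) powr (p - 1/2) * K) \<longlongrightarrow> 0) (at_right 0)" by simp
  qed (use p K in auto)
  then have "((\<lambda>t. ennreal (R t)) \<longlongrightarrow> 0) (at_right 0)"
    using tendsto_ennrealI by fastforce
  then show ?thesis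
  proof (rule tendsto_sandwich[OF _ _ tendsto_const, rotated 2])
    show "\<forall>\<^sub>F t in at_right 0. bmoa_norm p (h t) \<le> ennreal (R t)"
      using eventually_at_right_less[of 0] by eventually_elim (rule le)
  qed simp
qed

section \<open>Carleson squares and the vanishing Carleson condition\<close>

lemma bmoa_integrand_measurable:
  assumes f: "f holomorphic_on unit_disc" and a: "a \<in> unit_disc" and p: "1 \<le> p"
  shows "(\<lambda>z. ennreal (norm (deriv f z) powr p * (1 - (norm z)\<^sup>2) powr (p - 2)
      * (1 - (norm (disc_aut a z))\<^sup>2)) * indicator unit_disc z) \<in> borel_measurable area_measure"
proof -
  define g where "g = (\<lambda>z. norm (deriv f z) powr p * (1 - (norm z)\<^sup>2) powr (p - 2) * (1 - (norm (disc_aut a z))\<^sup>2))"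
  have "(\<lambda>z. indicator unit_disc z *\<^sub>R g z) \<in> borel_measurable borel"
  proof (rule borel_measurable_continuous_on_indicator)
    have ne: "1 - cnj a * z \<noteq> 0" if "z \<in> unit_disc" for z
      using norm_cnj_mult_less_one[OF a that] by auto
    have ne2: "(norm z)\<^sup>2 \<noteq> 1" if "z \<in> unit_disc" for z :: complex
      using that by (simp add: abs_square_less_1 less_imp_neq)
    have "deriv f holomorphic_on unit_disc" using f by (rule holomorphic_deriv) simp
    then have c1: "continuous_on unit_disc (\<lambda>z. norm (deriv f z) powr p)"
      using p by (intro continuous_on_powr' continuous_intros holomorphic_on_imp_continuous_on) auto
    have c2: "continuous_on unit_disc (\<lambda>z::complex. (1 - (norm z)\<^sup>2) powr (p - 2))"
      using ne2 by (intro continuous_intros) auto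
    have c3: "continuous_on unit_disc (\<lambda>z. 1 - (norm (disc_aut a z))\<^sup>2)"
      unfolding disc_aut_def using ne by (intro continuous_intros) auto
    show "continuous_on unit_disc g"
      unfolding g_def by (intro continuous_on_mult c1 c2 c3)
  qed simp
  then have "(\<lambda>z. ennreal (indicator unit_disc z *\<^sub>R g z)) \<in> borel_measurable borel"
    by (rule measurable_compose[OF _ measurable_ennreal])
  also have "(\<lambda>z. ennreal (indicator unit_disc z *\<^sub>R g z)) = (\<lambda>z. ennreal (g z) * indicator unit_disc z)"
    by (auto split: split_indicator)
  finally show ?thesis
    unfolding g_def area_measure_def
    by (simp add: measurable_def)
qed

lemma norm_one_minus_cis_le: "norm (1 - cis x) \<le> \<bar>x\<bar>"
proof -
  have "norm (1 - cis x) = norm (exp (\<i> * of_real x) - 1)"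
    by (simp add: cis_conv_exp norm_minus_commute)
  also have "\<dots> = 2 * \<bar>sin (x / 2)\<bar>" by (rule dist_exp_i_1)
  also have "\<dots> \<le> \<bar>x\<bar>" using abs_sin_x_le_abs_x[of "x / 2"] by simp
  finally show ?thesis .
qed

text \<open>The point \<open>a\<close> lies at height \<open>l\<close> below an endpoint of the arc.
  On the square, \<open>norm (1 - cnj a * z) \<le> 3 * l\<close>, with \<open>2 * l\<close> for the
  radial and \<open>l\<close> for the angular deviation, whereas
  \<open>1 - (norm a)\<^sup>2 \<ge> l\<close>. Averages over squares are thus dominated by
  \<open>bmoa_integral\<close> at \<open>a\<close>.\<close>

lemma carleson_square_lower_bound:
  assumes l: "0 < l" "l < 1" and I: "I \<subseteq> cis ` {\<alpha>..\<alpha> + l}" and z: "z \<in> carleson_square I l"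
  defines "a \<equiv> of_real (1 - l) * cis \<alpha>"
  shows "1 - l < norm z" and "z \<in> unit_disc" and "a \<in> unit_disc"
    and "1 - (norm z)\<^sup>2 \<le> 9 * l * (1 - (norm (disc_aut a z))\<^sup>2)"
proof -
  obtain r w where rw: "z = of_real r * w" "w \<in> I" "0 \<le> r" "1 - l < r" "r < 1"
    using z unfolding carleson_square_def by blast
  then obtain \<theta> where \<theta>: "w = cis \<theta>" "\<alpha> \<le> \<theta>" "\<theta> \<le> \<alpha> + l" using I by auto
  have nz: "norm z = r" using rw \<theta> by (simp add: norm_mult)
  show "1 - l < norm z" and zD: "z \<in> unit_disc" using nz rw by simp_all
  have na: "norm a = 1 - l" using l by (simp add: a_def norm_mult del: of_real_diff)
  show aD: "a \<in> unit_disc" using na l by simp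
  define x where "x = (1 - l) * r"
  have x: "0 \<le> x" "x \<le> 1" "1 - x \<le> 2 * l"
  proof -
    show "0 \<le> x" using l rw by (simp add: x_def)
    show "x \<le> 1" unfolding x_def using l rw by (intro mult_le_one) auto
    have "(1 - l) * (1 - l) \<le> x" unfolding x_def using l rw by (intro mult_left_mono) auto
    moreover have "(1 - l) * (1 - l) = 1 - 2 * l + l * l" by (simp add: algebra_simps)
    ultimately show "1 - x \<le> 2 * l" using l mult_pos_pos[of l l] by linarith
  qed
  have eq: "cnj a * z = of_real x * cis (\<theta> - \<alpha>)"
  proof -
    have "cis (\<theta> - \<alpha>) = cis (- \<alpha>) * cis \<theta>" by (simp add: cis_mult)
    then show ?thesis by (simp add: a_def rw(1) \<theta>(1) x_def cis_cnj mult_ac)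
  qed
  have "1 - cnj a * z = of_real (1 - x) + of_real x * (1 - cis (\<theta> - \<alpha>))"
    unfolding eq by (simp add: algebra_simps)
  then have "norm (1 - cnj a * z) \<le> norm (of_real (1 - x) :: complex) + norm (of_real x * (1 - cis (\<theta> - \<alpha>)))"
    by (metis norm_triangle_ineq)
  also have "\<dots> \<le> 2 * l + 1 * l"
  proof (rule add_mono)
    show "norm (of_real (1 - x) :: complex) \<le> 2 * l"
      using x unfolding norm_of_real by simp
    show "norm (of_real x * (1 - cis (\<theta> - \<alpha>))) \<le> 1 * l"
      unfolding norm_mult norm_of_real using x \<theta> norm_one_minus_cis_le[of "\<theta> - \<alpha>"]
      by (intro mult_mono) auto
  qed
  finally have "(norm (1 - cnj a * z))\<^sup>2 \<le> (3 * l)\<^sup>2" by (intro power_mono) auto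
  moreover have "0 < norm (1 - cnj a * z)"
    using norm_cnj_mult_less_one[OF aD zD] by auto
  moreover have "l \<le> 1 - (norm a)\<^sup>2"
  proof -
    have "1 - (norm a)\<^sup>2 = l + l * (1 - l)"
      unfolding na by (simp add: power2_eq_square algebra_simps)
    then show ?thesis using l by simp
  qed
  moreover have s: "0 \<le> 1 - (norm z)\<^sup>2" using zD by (simp add: abs_square_le_1)
  ultimately have "l * (1 - (norm z)\<^sup>2) / (3 * l)\<^sup>2 \<le> (1 - (norm a)\<^sup>2) * (1 - (norm z)\<^sup>2) / (norm (1 - cnj a * z))\<^sup>2"
    using l by (intro frac_le mult_right_mono mult_nonneg_nonneg) auto
  also have "\<dots> = 1 - (norm (disc_aut a z))\<^sup>2"
    using one_minus_norm_disc_aut[OF aD zD] by simp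
  finally have "(1 - (norm z)\<^sup>2) / (9 * l) \<le> 1 - (norm (disc_aut a z))\<^sup>2"
    using l by (simp add: power2_eq_square)
  then show "1 - (norm z)\<^sup>2 \<le> 9 * l * (1 - (norm (disc_aut a z))\<^sup>2)"
    using l by (subst (asm) pos_divide_le_eq) (simp_all add: mult.commute)
qed


text \<open>If \<open>P\<close> were not constant, its image would be open and contain 0, hence also
  points with negative real part.\<close>

lemma nonneg_Re_zero_everywhere:
  assumes P: "P holomorphic_on unit_disc" and nonneg: "\<And>z. z \<in> unit_disc \<Longrightarrow> 0 \<le> Re (P z)"
    and z: "z \<in> unit_disc" "P z = 0" and w: "w \<in> unit_disc"
  shows "P w = 0"
proof -
  have "P constant_on unit_disc"
  proof (rule ccontr)
    assume "\<not> P constant_on unit_disc"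
    then have "open (P ` unit_disc)"
      by (intro open_mapping_thm[OF P]) auto
    moreover have "0 \<in> P ` unit_disc" using z by force
    ultimately obtain e where e: "e > 0" "ball 0 e \<subseteq> P ` unit_disc"
      by (meson open_contains_ball)
    have "- of_real (e / 2) \<in> ball (0::complex) e" using e by (simp add: norm_divide)
    then obtain u where "u \<in> unit_disc" "P u = - of_real (e / 2)" using e by (metis imageE subsetD)
    then show False using nonneg[of u] e by simp
  qed
  then show ?thesis using z w by (metis constant_on_def)
qed

text \<open>Since \<open>1 / norm (G z) = norm (deriv \<gamma> z) / norm (z - b)\<close> and
  \<open>z - b\<close> stays away from 0 near the circle, the integrand on a square is at most
  \<open>K * l\<close> times the BMOA integrand at a point \<open>a\<close> with
  \<open>norm a = 1 - l\<close>. Division by \<open>l\<close> leaves a quantity that vanishes in the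
  limit.\<close>

lemma vanishing_carleson_if_VMOA:
  assumes p: "1 \<le> p" and \<gamma>: "\<gamma> \<in> VMOA p" and b: "b \<in> unit_disc"
    and ne: "\<And>z. z \<in> unit_disc \<Longrightarrow> deriv \<gamma> z \<noteq> 0"
    and G: "\<And>z. z \<in> unit_disc \<Longrightarrow> deriv \<gamma> z * G z = z - b"
    and \<epsilon>: "0 < \<epsilon>"
  shows "\<exists>\<delta>>0. \<forall>I l. circle_arc I l \<and> l < \<delta> \<longrightarrow>
    (\<integral>\<^sup>+z\<in>carleson_square I l.
        ennreal ((1 - (norm z)\<^sup>2) powr (p - 1)) / ennreal (norm (G z) powr p) \<partial>area_measure)
      / ennreal l < ennreal \<epsilon>"
proof -
  have hol: "\<gamma> holomorphic_on unit_disc" using \<gamma> by (simp add: VMOA_def BMOA_def)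
  \<comment> \<open>Half the distance from \<open>b\<close> to the circle: for \<open>l < c\<close>,
    every \<open>z\<close> in the square has
    \<open>norm (z - b) \<ge> 2 * c - l > c\<close>.\<close>
  define c where "c = (1 - norm b) / 2"
  have c: "0 < c" "c < 1" using b norm_ge_zero[of b] by (simp_all add: c_def del: norm_ge_zero)
  define K where "K = 9 / c powr p"
  have K: "0 < K" using c by (simp add: K_def)
  \<comment> \<open>Half of \<open>\<epsilon> / K\<close>, so that the final inequality is
    strict.\<close>
  have "\<forall>\<^sub>F a in filtercomap norm (at_left 1). bmoa_integral p \<gamma> a < ennreal (\<epsilon> / (2 * K))"
    using \<gamma> \<epsilon> K by (intro order_tendstoD(2)[where y = 0]) (simp_all add: VMOA_def)
  then obtain V where V: "eventually V (at_left (1::real))"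
      "\<And>a. V (norm a) \<Longrightarrow> bmoa_integral p \<gamma> a < ennreal (\<epsilon> / (2 * K))"
    unfolding eventually_filtercomap by blast
  obtain d where d: "d < 1" "\<And>y. d < y \<Longrightarrow> y < 1 \<Longrightarrow> V y"
    using V(1) by (auto simp: eventually_at_left_field)
  define \<delta> where "\<delta> = min c (1 - d)"
  have \<delta>: "0 < \<delta>" using c d by (simp add: \<delta>_def)
  have "(\<integral>\<^sup>+z\<in>carleson_square I l.
        ennreal ((1 - (norm z)\<^sup>2) powr (p - 1)) / ennreal (norm (G z) powr p) \<partial>area_measure)
      / ennreal l < ennreal \<epsilon>" if arc: "circle_arc I l" "l < \<delta>" for I l
  proof -
    obtain \<alpha> where l: "0 < l" and I: "I \<subseteq> cis ` {\<alpha>..\<alpha> + l}"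
      using arc(1) unfolding circle_arc_def by blast
    have lc: "l < c" "l < 1 - d" "l < 1" using arc(2) c by (simp_all add: \<delta>_def)
    define a where "a = of_real (1 - l) * cis \<alpha>"
    note square = carleson_square_lower_bound[OF l lc(3) I, folded a_def]
    have na: "norm a = 1 - l" using l lc by (simp add: a_def norm_mult del: of_real_diff)
    have aD: "a \<in> unit_disc" using na l by simp
    define X where "X = (\<lambda>z. norm (deriv \<gamma> z) powr p * (1 - (norm z)\<^sup>2) powr (p - 2)
        * (1 - (norm (disc_aut a z))\<^sup>2))"
    have le: "(1 - (norm z)\<^sup>2) powr (p - 1) / norm (G z) powr p \<le> K * l * X z" "0 < norm (G z) powr p"
      if z: "z \<in> carleson_square I l" for z
    proof -
      have zD: "z \<in> unit_disc" using square(2)[OF z] .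
      define s where "s = 1 - (norm z)\<^sup>2"
      have s: "0 < s" using zD by (simp add: s_def abs_square_less_1)
      define g where "g = norm (deriv \<gamma> z)"
      have g: "0 < g" using ne[OF zD] by (simp add: g_def)
      have "c + c - l \<le> norm z - norm b" using square(1)[OF z] unfolding c_def by (simp add: field_simps)
      then have zb: "c \<le> norm (z - b)" using lc norm_triangle_ineq2[of z b] by linarith
      have "g * norm (G z) = norm (z - b)"
        unfolding g_def by (metis G[OF zD] norm_mult)
      then have Gz: "norm (G z) = norm (z - b) / g" using g by (simp add: field_simps)
      have cg: "c / g \<le> norm (G z)" "0 < c / g" unfolding Gz using zb g c by (simp_all add: divide_right_mono)
      then have Gpos: "0 < norm (G z)" by linarith
      \<comment> \<open>Positivity turns the extended quotient, which would be infinite at a zero of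
        \<open>G\<close>, into a real one.\<close>
      then show "0 < norm (G z) powr p" by simp
      have "s powr (p - 1) / norm (G z) powr p \<le> s powr (p - 1) / (c / g) powr p"
        using cg p Gpos c g by (intro divide_left_mono powr_mono2 mult_pos_pos) simp_all
      also have "\<dots> = g powr p * s powr (p - 2) / c powr p * s"
      proof -
        have "s powr (p - 1) = s powr (p - 2) * s"
          using s powr_mult_base[of s "p - 2"] by (simp add: mult.commute)
        then show ?thesis using c g by (simp add: powr_divide)
      qed
      also have "\<dots> \<le> g powr p * s powr (p - 2) / c powr p * (9 * l * (1 - (norm (disc_aut a z))\<^sup>2))"
        using square(4)[OF z] unfolding s_def by (intro mult_left_mono) auto
      also have "\<dots> = K * l * X z"
        by (simp add: K_def X_def g_def s_def)
      finally show "(1 - (norm z)\<^sup>2) powr (p - 1) / norm (G z) powr p \<le> K * l * X z"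
        by (simp add: s_def)
    qed
    have "(\<integral>\<^sup>+z\<in>carleson_square I l.
        ennreal ((1 - (norm z)\<^sup>2) powr (p - 1)) / ennreal (norm (G z) powr p) \<partial>area_measure)
      \<le> (\<integral>\<^sup>+z. ennreal (K * l) * (ennreal (X z) * indicator unit_disc z) \<partial>area_measure)"
    proof (intro nn_integral_mono)
      fix z
      show "ennreal ((1 - (norm z)\<^sup>2) powr (p - 1)) / ennreal (norm (G z) powr p) * indicator (carleson_square I l) z
        \<le> ennreal (K * l) * (ennreal (X z) * indicator unit_disc z)"
      proof (cases "z \<in> carleson_square I l")
        case True
        have "ennreal ((1 - (norm z)\<^sup>2) powr (p - 1)) / ennreal (norm (G z) powr p)
          = ennreal ((1 - (norm z)\<^sup>2) powr (p - 1) / norm (G z) powr p)"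
          using le(2)[OF True] by (intro divide_ennreal) auto
        also have "\<dots> \<le> ennreal (K * l * X z)" by (rule ennreal_leI[OF le(1)[OF True]])
        also have "\<dots> = ennreal (K * l) * ennreal (X z)" using K l by (intro ennreal_mult') simp
        finally show ?thesis using True square(2)[OF True] by (simp only: indicator_simps mult_1_right)
      qed simp
    qed
    also have "\<dots> = ennreal (K * l) * bmoa_integral p \<gamma> a"
      unfolding bmoa_integral_def X_def
      by (rule nn_integral_cmult[OF bmoa_integrand_measurable[OF hol aD p]])
    also have "\<dots> \<le> ennreal (K * l) * ennreal (\<epsilon> / (2 * K))"
      using d(2)[of "norm a"] na l lc by (intro mult_left_mono[OF less_imp_le[OF V(2)]]) auto
    also have "\<dots> = ennreal (\<epsilon> / 2 * l)"
      using K l \<epsilon> by (simp flip: ennreal_mult)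
    finally have "(\<integral>\<^sup>+z\<in>carleson_square I l.
        ennreal ((1 - (norm z)\<^sup>2) powr (p - 1)) / ennreal (norm (G z) powr p) \<partial>area_measure) / ennreal l
      \<le> ennreal (\<epsilon> / 2 * l) / ennreal l" by (rule divide_right_mono_ennreal)
    also have "\<dots> = ennreal (\<epsilon> / 2)" using l \<epsilon> by (subst divide_ennreal) simp_all
    also have "\<dots> < ennreal \<epsilon>" using \<epsilon> by (simp add: ennreal_less_iff)
    finally show ?thesis .
  qed
  then show ?thesis using \<delta> by blast
qed

section \<open>Strong continuity at the primitive \<open>\<gamma>\<close>\<close>

theorem theorem5:
  fixes p :: real and \<phi> :: "real \<Rightarrow> complex \<Rightarrow> complex"
    and G :: "complex \<Rightarrow> complex" and b :: complex
  assumes "1 \<le> p"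
    and "disc_semigroup \<phi>"
    and "infinitesimal_generator \<phi> G"
    and "denjoy_wolff_point \<phi> b" and "b \<in> unit_disc"
    and "VMOA p = strong_continuity_subspace \<phi> (BMOA p) (bmoa_norm p)"
  shows "\<forall>\<epsilon>>0. \<exists>\<delta>>0. \<forall>I l. circle_arc I l \<and> l < \<delta> \<longrightarrow>
    (\<integral>\<^sup>+z\<in>carleson_square I l.
        ennreal ((1 - (norm z)\<^sup>2) powr (p - 1)) / ennreal (norm (G z) powr p) \<partial>area_measure)
      / ennreal l < ennreal \<epsilon>"
proof -
  note p = \<open>1 \<le> p\<close> and \<phi> = \<open>disc_semigroup \<phi>\<close> and G = \<open>infinitesimal_generator \<phi> G\<close>
    and b = \<open>b \<in> unit_disc\<close>
  note self = disc_semigroup_self_map[OF \<phi>]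
  obtain G' P where G': "infinitesimal_generator \<phi> G'" and P: "P holomorphic_on unit_disc"
    and PG': "\<And>z. z \<in> unit_disc \<Longrightarrow> 0 \<le> Re (P z) \<and> G' z = (cnj b * z - 1) * (z - b) * P z"
    using \<open>denjoy_wolff_point \<phi> b\<close> unfolding denjoy_wolff_point_def by blast
  \<comment> \<open>Limits are unique, so \<open>G\<close> inherits the Berkson-Porta formula of
    \<open>G'\<close> on the disc.\<close>
  have Gz: "G z = (cnj b * z - 1) * (z - b) * P z" if "z \<in> unit_disc" for z
  proof -
    have "G z = G' z"
      using G G' that unfolding infinitesimal_generator_def
      by (intro tendsto_unique[of "at_right (0::real)" "\<lambda>t. (\<phi> t z - z) / of_real t"]) auto
    then show ?thesis using PG'[OF that] by simp
  qed
  have ReP: "0 \<le> Re (P z)" if "z \<in> unit_disc" for z using PG'[OF that] by simp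
  have cb: "cnj b * z - 1 \<noteq> 0" if "z \<in> unit_disc" for z
    using norm_cnj_mult_less_one[OF b that] by auto
  \<comment> \<open>The only use of the hypothesis on \<open>VMOA p\<close>: a bound on the
    derivatives of \<open>f \<circ> \<phi> t - f\<close> that is uniform in \<open>t\<close> puts
    \<open>f\<close> into the strong continuity subspace. It serves for the logarithm, when the
    semigroup is trivial, and for \<open>\<gamma>\<close>.\<close>
  have strong: "f \<in> VMOA p"
    if f: "f \<in> BMOA p" and Q: "Q holomorphic_on unit_disc" "\<And>z. z \<in> unit_disc \<Longrightarrow> 0 < Re (Q z)"
      and fG: "\<And>z. z \<in> unit_disc \<Longrightarrow> norm (deriv f z * G z) \<le> 2"
      and "0 \<le> C" and C: "\<And>t z. 0 < t \<Longrightarrow> z \<in> unit_disc \<Longrightarrow>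
        norm (deriv f (\<phi> t z) * deriv (\<phi> t) z - deriv f z) \<le> C * norm (Q z)" for f Q C
  proof -
    have hol: "f holomorphic_on unit_disc" using f by (simp add: BMOA_def)
    have der: "((\<lambda>z. f (\<phi> t z) - f z) has_field_derivative
        (deriv f (\<phi> t z) * deriv (\<phi> t) z - deriv f z)) (at z)" if "0 < t" "z \<in> unit_disc" for t z
    proof -
      have t: "0 \<le> t" using that by simp
      show ?thesis
        using that self(3)[OF t that(2)] self(1)[OF t] hol
        by (intro DERIV_diff DERIV_chain2[of f] holomorphic_derivI[of _ unit_disc]) auto
    qed
    have "((\<lambda>t. bmoa_norm p (\<lambda>z. f (\<phi> t z) - f z)) \<longlongrightarrow> 0) (at_right 0)"
    proof (rule bmoa_norm_tendsto_zero[OF p Q \<open>0 \<le> C\<close>])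
      show "(\<lambda>z. f (\<phi> t z) - f z) holomorphic_on unit_disc" if "0 < t" for t
        unfolding holomorphic_on_open[OF open_ball] using der[OF that] by blast
      show "norm (f (\<phi> t z) - f z) \<le> 2 * t" if "0 < t" "z \<in> unit_disc" for t z
        using semigroup_orbit_bound[OF \<phi> G hol fG _ that(2)] that(1) by simp
      show "norm (deriv (\<lambda>z. f (\<phi> t z) - f z) z) \<le> C * norm (Q z)" if "0 < t" "z \<in> unit_disc" for t z
        using C[OF that] DERIV_imp_deriv[OF der[OF that]] by simp
    qed
    then show ?thesis
      using f unfolding assms(6) strong_continuity_subspace_def by blast
  qed
  \<comment> \<open>A trivial semigroup is strongly continuous on the whole of \<open>BMOA p\<close>, which is larger than \<open>VMOA p\<close>.\<close>
  have P0: "P z \<noteq> 0" if "z \<in> unit_disc" for z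
  proof
    assume "P z = 0"
    then have "P w = 0" if "w \<in> unit_disc" for w
      using nonneg_Re_zero_everywhere[OF P ReP \<open>z \<in> unit_disc\<close>] that by blast
    then have G0: "G w = 0" if "w \<in> unit_disc" for w
      using Gz[OF that] that by simp
    \<comment> \<open>With \<open>G = 0\<close> points do not move, so each
      \<open>f \<circ> \<phi> t - f\<close> vanishes on the disc; hence \<open>C = 0\<close>
      below.\<close>
    have id: "\<phi> t w = w" if "0 < t" "w \<in> unit_disc" for t w
      using semigroup_orbit_bound[OF \<phi> G, of "\<lambda>z. z" 0 t w] G0 that by simp
    let ?f = "\<lambda>z::complex. Ln (1 - z)"
    have "?f \<in> VMOA p"
    proof (rule strong[where Q = "\<lambda>_. 1" and C = 0])
      show "norm (deriv ?f (\<phi> t w) * deriv (\<phi> t) w - deriv ?f w) \<le> 0 * norm (1::complex)"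
        if "0 < t" "w \<in> unit_disc" for t w
      proof -
        have "(\<phi> t has_field_derivative 1) (at w)"
          by (rule has_field_derivative_transform_within_open[OF DERIV_ident, of unit_disc])
             (use that id in auto)
        then show ?thesis using id[OF that] by (simp add: DERIV_imp_deriv)
      qed
    qed (use log_BMOA[OF p] G0 in auto)
    then show False using log_not_VMOA[OF p] by contradiction
  qed
  define g where "g = (\<lambda>z. 1 / ((cnj b * z - 1) * P z))"
  have g_hol: "g holomorphic_on unit_disc"
    unfolding g_def using P P0 cb by (intro holomorphic_intros) auto
  obtain \<gamma> where "\<And>z. z \<in> unit_disc \<Longrightarrow> (\<gamma> has_field_derivative g z) (at z within unit_disc)"
    using holomorphic_convex_primitive'[OF convex_ball open_ball g_hol] by blast
  then have \<gamma>: "(\<gamma> has_field_derivative g z) (at z)" if "z \<in> unit_disc" for z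
    using that by (metis at_within_open open_ball)
  then have d\<gamma>: "deriv \<gamma> z = g z" if "z \<in> unit_disc" for z
    using that by (simp add: DERIV_imp_deriv)
  have \<gamma>_hol: "\<gamma> holomorphic_on unit_disc" 
    unfolding holomorphic_on_open[OF open_ball] using \<gamma> by blast
  have g0: "g z \<noteq> 0" if "z \<in> unit_disc" for z using P0[OF that] cb[OF that] by (simp add: g_def)
  have gG: "g z * G z = z - b" if "z \<in> unit_disc" for z
    using P0[OF that] cb[OF that] by (simp add: g_def Gz[OF that])
  \<comment> \<open>The real part of \<open>1 / P\<close> may be zero; adding 1 makes it strictly
    positive and does not decrease the modulus.\<close>
  define Q where "Q = (\<lambda>z. 1 / P z + 1)"
  have Q: "Q holomorphic_on unit_disc"
    unfolding Q_def using P P0 by (intro holomorphic_intros) auto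
  have ReP': "0 \<le> Re (1 / P z)" if "z \<in> unit_disc" for z
    using ReP[OF that] by (simp add: Re_divide)
  have posQ: "0 < Re (Q z)" if "z \<in> unit_disc" for z
    using ReP'[OF that] unfolding Q_def by simp
  define A where "A = 1 / (1 - norm b)"
  have nb: "norm b < 1" using b by simp
  have A: "0 < A" using nb by (simp add: A_def)
  have gQ: "norm (g z) \<le> A * norm (Q z)" if z: "z \<in> unit_disc" for z
  proof -
    have "(norm (1 / P z))\<^sup>2 \<le> (norm (Q z))\<^sup>2"
      using ReP'[OF z] unfolding Q_def cmod_power2 by (simp add: power2_eq_square algebra_simps)
    then have PQ: "norm (1 / P z) \<le> norm (Q z)" by (rule power2_le_imp_le) simp
    have "norm (cnj b * z) \<le> norm b * 1" using z unfolding norm_mult by (intro mult_mono) auto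
    then have "1 - norm b \<le> norm (cnj b * z - 1)"
      using norm_triangle_ineq2[of 1 "cnj b * z"] by (simp add: norm_minus_commute)
    then have "1 / norm (cnj b * z - 1) \<le> A"
      unfolding A_def using nb by (intro divide_left_mono mult_pos_pos) auto
    then have "1 / norm (cnj b * z - 1) * norm (1 / P z) \<le> A * norm (Q z)"
      using PQ A by (intro mult_mono) auto
    then show ?thesis by (simp add: g_def norm_mult norm_divide)
  qed
  have BMOA: "\<gamma> \<in> BMOA p"
    using gQ d\<gamma> A by (intro BMOA_if_deriv_dominated[OF p \<gamma>_hol Q posQ, of A]) auto
  \<comment> \<open>The first two terms bound \<open>norm (\<phi> t z - z) / norm (z - b)\<close>
    for \<open>z \<noteq> b\<close>; the third, together with 1, bounds
    \<open>norm (deriv (\<phi> t) b - 1)\<close>. All are uniform in \<open>t\<close>.\<close>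
  define L where "L = 1 + 2 / (1 - norm b) + 2 / (1 - (norm b)\<^sup>2)"
  have nb2: "0 < 1 - (norm b)\<^sup>2" using nb by (simp add: abs_square_less_1)
  have L: "0 < L" using nb nb2 by (simp add: L_def add_pos_pos)
  have "\<gamma> \<in> VMOA p"
  proof (rule strong[OF BMOA Q posQ, of "L * A"])
    show "0 \<le> L * A" using L A by simp
    show "norm (deriv \<gamma> z * G z) \<le> 2" if z: "z \<in> unit_disc" for z
      using gG[OF z] norm_triangle_ineq4[of z b] z nb by (simp add: d\<gamma>[OF z])
    fix t :: real and z :: complex assume t: "0 < t" and z: "z \<in> unit_disc"
    note t0 = less_imp_le[OF t]
    have \<phi>z: "\<phi> t z \<in> unit_disc" and \<phi>b: "\<phi> t b \<in> unit_disc" using self(3)[OF t0] z b by auto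
    \<comment> \<open>\<open>G\<close> vanishes at \<open>b\<close>, hence at
      \<open>\<phi> t b\<close> by \<open>generator_commutes\<close>, and
      \<open>g * G = z - b\<close> leaves \<open>b\<close> as its only zero.\<close>
    have fix_b: "\<phi> t b = b"
    proof -
      have "G (\<phi> t b) = 0"
        using generator_commutes[OF \<phi> G t0 b] Gz[OF b] by simp
      then show ?thesis using gG[OF \<phi>b] by simp
    qed
    have "norm (g (\<phi> t z) * deriv (\<phi> t) z - g z) \<le> L * norm (g z)"
    \<comment> \<open>At \<open>b\<close> the factor \<open>z - b\<close> cannot be cancelled; there
      the fixed point reduces the difference to
      \<open>(deriv (\<phi> t) b - 1) * g b\<close>.\<close>
    proof (cases "z = b")
      case True
      have "norm (deriv (\<phi> t) b) \<le> 2 * 1 / (1 - (norm b)\<^sup>2)"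
        using self(1)[OF t0] self(3)[OF t0] b by (intro disc_deriv_bound) (auto simp: less_imp_le)
      then have "norm (deriv (\<phi> t) b - 1) \<le> 2 / (1 - (norm b)\<^sup>2) + 1"
        using norm_triangle_ineq4[of "deriv (\<phi> t) b" 1] by simp
      also have "\<dots> \<le> L" using nb by (simp add: L_def)
      finally have "norm (deriv (\<phi> t) b - 1) * norm (g b) \<le> L * norm (g b)"
        by (rule mult_right_mono) simp
      moreover have "g b * deriv (\<phi> t) b - g b = (deriv (\<phi> t) b - 1) * g b"
        by (simp add: algebra_simps)
      ultimately show ?thesis using True fix_b by (simp add: norm_mult)
    next
      case False
      have "norm (\<phi> t z - z) \<le> norm (\<phi> t z - \<phi> t b) + norm (z - b)"
        using norm_triangle_ineq4[of "\<phi> t z - \<phi> t b" "z - b"] fix_b by simp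
      also have "\<dots> \<le> 2 * norm (z - b) / (1 - norm b) + norm (z - b)"
        using disc_self_map_lipschitz[OF self(1,2)[OF t0] z b] by simp
      also have "\<dots> = (1 + 2 / (1 - norm b)) * norm (z - b)"
        by (simp add: algebra_simps)
      also have "\<dots> \<le> L * norm (z - b)"
        using nb2 by (intro mult_right_mono) (simp_all add: L_def)
      finally have lip: "norm (\<phi> t z - z) \<le> L * norm (z - b)" .
      \<comment> \<open>One factor \<open>z - b\<close> is written as \<open>g z * G z\<close>, so
        that \<open>deriv (\<phi> t) z * G z = G (\<phi> t z)\<close> and
        \<open>g (\<phi> t z) * G (\<phi> t z) = \<phi> t z - b\<close> can be inserted.\<close>
      have "(z - b) * (g (\<phi> t z) * deriv (\<phi> t) z - g z)
          = g (\<phi> t z) * (deriv (\<phi> t) z * G z) * g z - (z - b) * g z"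
        unfolding gG[OF z, symmetric] by (simp add: algebra_simps)
      also have "\<dots> = (\<phi> t z - z) * g z"
        unfolding generator_commutes[OF \<phi> G t0 z] gG[OF \<phi>z] by (simp add: algebra_simps)
      finally have "norm (z - b) * norm (g (\<phi> t z) * deriv (\<phi> t) z - g z) = norm (\<phi> t z - z) * norm (g z)"
        by (metis norm_mult)
      also have "\<dots> \<le> norm (z - b) * (L * norm (g z))"
        using mult_right_mono[OF lip, of "norm (g z)"] by (simp add: mult_ac)
      finally show ?thesis using False by simp
    qed
    also have "\<dots> \<le> L * (A * norm (Q z))"
      using gQ[OF z] L by (intro mult_left_mono) auto
    finally show "norm (deriv \<gamma> (\<phi> t z) * deriv (\<phi> t) z - deriv \<gamma> z) \<le> L * A * norm (Q z)"
      by (simp add: d\<gamma>[OF z] d\<gamma>[OF \<phi>z] mult.assoc)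
  qed
  then show ?thesis
    using g0 gG d\<gamma> by (intro allI impI vanishing_carleson_if_VMOA[OF p _ b]) auto
qed

end
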